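(* Let $\Phi$ be a computable PCA with a unique invariant measure $\pi$. Then $\pi$ is computable.
   Context: Let $S$ be a finite set, $d\ge 1$, and $\mathcal{X}=S^{\mathbb{Z}^d}$ with the product topology. For finite $K\subseteq\mathbb{Z}^d$ and $y_K\in S^K$, the cylinder $[y_K]$ is $\{x\in\mathcal{X}: x_k=y_k\ \forall k\in K\}$. A probabilistic cellular automaton (PCA) with neighbourhood $\{n_1,\dots,n_m\}\subseteq\mathbb{Z}^d$ and local rule $\varphi:S^m\times S\to[0,1]$ (a stochastic matrix) is the Markov kernel $\Phi$ on $\mathcal{X}$ with $\Phi(x,[y_K])=\prod_{k\in K}\varphi(x_{k+n_1},\dots,x_{k+n_m})(y_k)$ for every cylinder. A Borel probability measure $\pi$ on $\mathcal{X}$ is invariant if $\pi\Phi=\pi$. A real number $x$ is computable if there is a computable function $f_x:\mathbb{N}\to\mathbb{Q}$ with $|f_x(n)-x|<1/n$ for all $n\in\mathbb{N}$. A PCA is computable if all values of its local rule $\varphi$ are computable real numbers. Let $S^{\#}$ denote the set of all patterns $u\in S^A$ with $A\subseteq\mathbb{Z}^d$ finite. A Borel probability measure $\mu$ on $\mathcal{X}$ is computable if there is a computable function $f_\mu:S^{\#}\times\mathbb{N}\to\mathbb{Q}$ with $|f_\mu(u,n)-\mu([u])|<1/n$ for every $u\in S^{\#}$ and $n\in\mathbb{N}$. Here $\mathbb{N}$ in the accuracy parameter means positive integers. *)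

theory Defs
  imports "HOL-Probability.Probability"
begin

section \<open>Computability\<close>

text \<open>
  Total recursive functions in the sense of Kleene. In \<^term>\<open>recursive_fn n f\<close> the first
  argument is the arity: only the values of \<open>f\<close> on lists of length \<open>n\<close> are meaningful.
  Minimization is applied to regular functions only, so that every function obtained is total;
  the resulting class is that of all total Turing-computable functions.
\<close>

inductive recursive_fn :: "nat \<Rightarrow> (nat list \<Rightarrow> nat) \<Rightarrow> bool" where
  zero: "recursive_fn n (\<lambda>xs. 0)"
| succ: "recursive_fn 1 (\<lambda>xs. Suc (hd xs))"
| proj: "i < n \<Longrightarrow> recursive_fn n (\<lambda>xs. xs ! i)"
| comp: "recursive_fn (length fs) g \<Longrightarrow> (\<forall>f\<in>set fs. recursive_fn n f) \<Longrightarrow>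
    recursive_fn n (\<lambda>xs. g (map (\<lambda>f. f xs) fs))"
| prec: "recursive_fn n g \<Longrightarrow> recursive_fn (n + 2) h \<Longrightarrow>
    recursive_fn (n + 1)
      (\<lambda>xs. rec_nat (g (tl xs)) (\<lambda>y r. h (y # r # tl xs)) (hd xs))"
| minim: "recursive_fn (n + 1) f \<Longrightarrow> (\<forall>xs. length xs = n \<longrightarrow> (\<exists>y. f (y # xs) = 0)) \<Longrightarrow>
    recursive_fn n (\<lambda>xs. LEAST y. f (y # xs) = 0)"

text \<open>
  Rationals are output through \<^const>\<open>nat_to_rat_surj\<close>, which reads a number as a pair of
  integers (numerator and denominator).
\<close>

definition computable_rat_seq :: "(nat \<Rightarrow> rat) \<Rightarrow> bool" where
  "computable_rat_seq f \<longleftrightarrow>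
    (\<exists>g. recursive_fn 1 g \<and> (\<forall>n. f n = nat_to_rat_surj (g [n])))"

definition computable_real :: "real \<Rightarrow> bool" where
  "computable_real x \<longleftrightarrow>
    (\<exists>f. computable_rat_seq f \<and> (\<forall>n>0. \<bar>of_rat (f n) - x\<bar> < 1 / real n))"


section \<open>Configurations and patterns\<close>

type_synonym 'd site = "int ^ 'd"
type_synonym ('d, 's) config = "'d site \<Rightarrow> 's"

text \<open>A pattern is a partial map with finite domain \<open>A\<close>, i.e. an element of \<open>S\<^sup>A\<close>.\<close>

type_synonym ('d, 's) pattern = "'d site \<rightharpoonup> 's"

definition patterns :: "('d::finite, 's) pattern set" where
  "patterns = {u. finite (dom u)}"

definition cylinder :: "('d::finite, 's) pattern \<Rightarrow> ('d, 's) config set" where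
  "cylinder u = {x. \<forall>k\<in>dom u. u k = Some (x k)}"

definition config_topology :: "('d::finite, 's) config topology" where
  "config_topology = product_topology (\<lambda>_. discrete_topology UNIV) UNIV"

definition config_borel :: "('d::finite, 's) config measure" where
  "config_borel = sigma UNIV {U. openin config_topology U}"

definition borel_prob :: "('d::finite, 's) config measure \<Rightarrow> bool" where
  "borel_prob \<mu> \<longleftrightarrow> prob_space \<mu> \<and> sets \<mu> = sets config_borel"

text \<open>
  Codes of patterns. The order of the coordinates and the numbering \<^const>\<open>to_nat\<close> of the finite
  alphabet are arbitrary but fixed; being finite data, they do not affect computability. The
  codes of integers, lists, pairs and finite sets are the explicit ones of
  \<^theory>\<open>HOL-Library.Nat_Bijection\<close>. In particular \<^const>\<open>to_nat\<close> must not be applied to sites,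
  where an arbitrary injection into the naturals need not be computable.
\<close>

definition coords :: "'d::finite list" where
  "coords = (SOME is. distinct is \<and> set is = UNIV)"

definition site_code :: "'d::finite site \<Rightarrow> nat" where
  "site_code k = list_encode (map (\<lambda>i. int_encode (k $ i)) coords)"

definition pattern_code :: "('d::finite, 's::finite) pattern \<Rightarrow> nat" where
  "pattern_code u =
    set_encode ((\<lambda>k. prod_encode (site_code k, to_nat (the (u k)))) ` dom u)"

text \<open>The codes of patterns form a decidable set, so it is immaterial that \<open>g\<close> is total.\<close>

definition computable_pattern_fn :: "(('d::finite, 's::finite) pattern \<Rightarrow> nat \<Rightarrow> rat) \<Rightarrow> bool" where
  "computable_pattern_fn f \<longleftrightarrow>
    (\<exists>g. recursive_fn 2 g \<and>
      (\<forall>u\<in>patterns. \<forall>n. f u n = nat_to_rat_surj (g [pattern_code u, n])))"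

definition computable_measure :: "('d::finite, 's::finite) config measure \<Rightarrow> bool" where
  "computable_measure \<mu> \<longleftrightarrow>
    (\<exists>f. computable_pattern_fn f \<and>
      (\<forall>u\<in>patterns. \<forall>n>0. \<bar>of_rat (f u n) - measure \<mu> (cylinder u)\<bar> < 1 / real n))"


section \<open>Probabilistic cellular automata\<close>

text \<open>
  The neighbourhood is the list \<open>ns = [n\<^sub>1, \<dots>, n\<^sub>m]\<close>, and \<open>S\<^sup>m\<close> is the set of lists over \<open>S\<close> of
  length \<open>m\<close>; values of \<open>\<phi>\<close> on other lists are irrelevant.
\<close>

definition local_rule :: "'d::finite site list \<Rightarrow> ('s::finite list \<Rightarrow> 's \<Rightarrow> real) \<Rightarrow> bool" where
  "local_rule ns \<phi> \<longleftrightarrow>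
    (\<forall>v. length v = length ns \<longrightarrow> (\<forall>s. \<phi> v s \<in> {0..1}) \<and> (\<Sum>s\<in>UNIV. \<phi> v s) = 1)"

definition pca ::
  "'d::finite site list \<Rightarrow> ('s::finite list \<Rightarrow> 's \<Rightarrow> real) \<Rightarrow>
    (('d, 's) config \<Rightarrow> ('d, 's) config measure) \<Rightarrow> bool" where
  "pca ns \<phi> \<Phi> \<longleftrightarrow>
    local_rule ns \<phi> \<and>
    \<Phi> \<in> config_borel \<rightarrow>\<^sub>M prob_algebra config_borel \<and>
    (\<forall>x. \<forall>u\<in>patterns.
      measure (\<Phi> x) (cylinder u) = (\<Prod>k\<in>dom u. \<phi> (map (\<lambda>n. x (k + n)) ns) (the (u k))))"

definition computable_rule :: "'d::finite site list \<Rightarrow> ('s::finite list \<Rightarrow> 's \<Rightarrow> real) \<Rightarrow> bool" where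
  "computable_rule ns \<phi> \<longleftrightarrow>
    (\<forall>v s. length v = length ns \<longrightarrow> computable_real (\<phi> v s))"

definition invariant_measure ::
  "(('d::finite, 's) config \<Rightarrow> ('d, 's) config measure) \<Rightarrow> ('d, 's) config measure \<Rightarrow> bool" where
  "invariant_measure \<Phi> \<pi> \<longleftrightarrow> borel_prob \<pi> \<and> \<pi> \<bind> \<Phi> = \<pi>"

end

(* Let P be the transition operator and f a function of finitely many sites. For every c above
   the integral of f there is a local g >= 0 with f + g <= c + P g: otherwise a limit point of
   Cesaro means, taken at configurations where they exceed c, would be a second invariant
   measure. Conversely integrating such an inequality against the invariant measure gives the
   bound c. It involves only finitely many sites and one step of the automaton, and it survives
   rational approximation of g and of the local rule from below. So one searches for such
   certificates for the indicator of a cylinder and for that of its complement, until the two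
   bounds they give differ by less than 1/n. *)

theory Submission
  imports Defs
begin

text \<open>Uniqueness gives no rate of convergence of the Cesaro means, so the algorithm has to be
  an unbounded search for a finite object that can be verified. The obstacle is that the local rule
  consists of real numbers, whose comparison is undecidable. This is what the sign condition
  \<open>g \<ge> 0\<close> is for: lower approximations of the rule can only decrease
  \<open>P g\<close>, so an inequality verified for them in exact integer arithmetic is a true one,
  while a strict gap in the bound leaves room for the rounding once the denominator is large.

  The function \<open>g\<close> is obtained by telescoping: \<open>f\<close> differs from its Cesaro
  mean by \<open>P h - h\<close>, where \<open>h\<close> is a finite combination of iterates of
  \<open>f\<close>, so a bound on the mean over many steps becomes an inequality about one step.
  Adding a constant to \<open>h\<close> makes it nonnegative and preserves the inequality.

  Minimization is available only for searches that succeed on every input. Hence the search is set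
  up for all pairs of numbers, including numbers that code no pattern and the accuracy parameter
  0.\<close>

section \<open>Closure properties of the recursive functions\<close>

text \<open>\<open>recursive_fn\<close> is attached to a function on all lists, although only lists
  of length \<open>n\<close> matter. Closing it under agreement on those lists allows a function to
  be replaced by any expression with the same meaningful values.\<close>

definition rec_fn :: "nat \<Rightarrow> (nat list \<Rightarrow> nat) \<Rightarrow> bool" where
  "rec_fn n f \<longleftrightarrow> (\<exists>g. recursive_fn n g \<and> (\<forall>xs. length xs = n \<longrightarrow> g xs = f xs))"

definition rec_pred :: "nat \<Rightarrow> (nat list \<Rightarrow> bool) \<Rightarrow> bool" where
  "rec_pred n P \<longleftrightarrow> rec_fn n (\<lambda>xs. of_bool (P xs))"

lemma rec_fn_cong: "rec_fn n f \<Longrightarrow> (\<And>xs. length xs = n \<Longrightarrow> f xs = g xs) \<Longrightarrow> rec_fn n g"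
  by (force simp: rec_fn_def)

lemma rec_fn_nth: "i < n \<Longrightarrow> rec_fn n (\<lambda>xs. xs ! i)"
  using recursive_fn.proj by (auto simp: rec_fn_def)

lemma rec_fn_comp:
  assumes h: "rec_fn (length fs) h" and fs: "\<forall>f\<in>set fs. rec_fn n f"
  shows "rec_fn n (\<lambda>xs. h (map (\<lambda>f. f xs) fs))"
proof -
  obtain h' where h': "recursive_fn (length fs) h'" "\<And>xs. length xs = length fs \<Longrightarrow> h' xs = h xs"
    using h by (auto simp: rec_fn_def)
  obtain G where G: "\<And>f. f \<in> set fs \<Longrightarrow> recursive_fn n (G f)"
      "\<And>f xs. f \<in> set fs \<Longrightarrow> length xs = n \<Longrightarrow> G f xs = f xs"
    using fs unfolding rec_fn_def by metis
  have "recursive_fn n (\<lambda>xs. h' (map (\<lambda>f. f xs) (map G fs)))"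
    by (rule recursive_fn.comp) (use h' G in auto)
  moreover have "h' (map (\<lambda>f. f xs) (map G fs)) = h (map (\<lambda>f. f xs) fs)" if "length xs = n" for xs
  proof -
    have "map (\<lambda>f. f xs) (map G fs) = map (\<lambda>f. f xs) fs" using G(2) that by auto
    then show ?thesis using h'(2)[of "map (\<lambda>f. f xs) (map G fs)"] by (simp only: length_map)
  qed
  ultimately show ?thesis unfolding rec_fn_def by blast
qed

lemma rec_fn_comp1: "rec_fn 1 (\<lambda>xs. h (xs ! 0)) \<Longrightarrow> rec_fn n f \<Longrightarrow> rec_fn n (\<lambda>xs. h (f xs))"
  using rec_fn_comp[of "[f]" "\<lambda>xs. h (xs ! 0)" n] by simp

lemma rec_fn_comp2:
  "rec_fn 2 (\<lambda>xs. h (xs ! 0) (xs ! 1)) \<Longrightarrow> rec_fn n f \<Longrightarrow> rec_fn n g \<Longrightarrow> rec_fn n (\<lambda>xs. h (f xs) (g xs))"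
  using rec_fn_comp[of "[f, g]" "\<lambda>xs. h (xs ! 0) (xs ! 1)" n] by (simp add: numeral_2_eq_2)

lemma rec_fn_Suc: "rec_fn n f \<Longrightarrow> rec_fn n (\<lambda>xs. Suc (f xs))"
  by (rule rec_fn_comp1) (use recursive_fn.succ in \<open>auto simp: rec_fn_def hd_conv_nth length_Suc_conv\<close>)

lemma rec_fn_const: "rec_fn n (\<lambda>xs. c)"
proof (induction c)
  case 0 show ?case using recursive_fn.zero by (auto simp: rec_fn_def)
qed (rule rec_fn_Suc)

lemma rec_fn_tl: assumes "rec_fn n f" shows "rec_fn (Suc n) (\<lambda>xs. f (tl xs))"
proof -
  have "rec_fn (Suc n) (\<lambda>xs. f (map (\<lambda>f. f xs) (map (\<lambda>i xs. xs ! Suc i) [0..<n])))"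
    by (rule rec_fn_comp) (use assms in \<open>auto intro: rec_fn_nth\<close>)
  then show ?thesis
  proof (rule rec_fn_cong)
    fix xs :: "nat list" assume "length xs = Suc n"
    then have "map (\<lambda>f. f xs) (map (\<lambda>i xs. xs ! Suc i) [0..<n]) = tl xs"
      by (intro nth_equalityI) (auto simp: nth_tl)
    then show "f (map (\<lambda>f. f xs) (map (\<lambda>i xs. xs ! Suc i) [0..<n])) = f (tl xs)" by simp
  qed
qed

lemma rec_fn_Cons: assumes f: "rec_fn (Suc n) f" and b: "rec_fn n b" shows "rec_fn n (\<lambda>xs. f (b xs # xs))"
proof -
  have "rec_fn n (\<lambda>xs. f (map (\<lambda>f. f xs) (b # map (\<lambda>i xs. xs ! i) [0..<n])))"
    by (rule rec_fn_comp) (use assms in \<open>auto intro: rec_fn_nth\<close>)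
  then show ?thesis
  proof (rule rec_fn_cong)
    fix xs :: "nat list" assume "length xs = n"
    then have "map (\<lambda>f. f xs) (map (\<lambda>i xs. xs ! i) [0..<n]) = xs"
      by (intro nth_equalityI) auto
    then show "f (map (\<lambda>f. f xs) (b # map (\<lambda>i xs. xs ! i) [0..<n])) = f (b xs # xs)" by simp
  qed
qed

text \<open>The counter and the accumulator sit at the head of the argument list and the parameters
  in the tail, in the manner of de Bruijn indices. The bound variable of a sum, product, quantifier
  or minimization below is placed in the same way.\<close>

lemma rec_fn_rec:
  assumes b: "rec_fn n b" and g: "rec_fn n g"
    and h: "rec_fn (Suc (Suc n)) (\<lambda>xs. h (xs ! 0) (xs ! 1) (tl (tl xs)))"
  shows "rec_fn n (\<lambda>xs. rec_nat (g xs) (\<lambda>y r. h y r xs) (b xs))"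
proof -
  obtain g' where g': "recursive_fn n g'" "\<And>xs. length xs = n \<Longrightarrow> g' xs = g xs"
    using g by (auto simp: rec_fn_def)
  obtain h' where h': "recursive_fn (n + 2) h'"
      "\<And>xs. length xs = Suc (Suc n) \<Longrightarrow> h' xs = h (xs ! 0) (xs ! 1) (tl (tl xs))"
    using h by (auto simp: rec_fn_def)
  have "rec_fn (Suc n) (\<lambda>xs. rec_nat (g (tl xs)) (\<lambda>y r. h y r (tl xs)) (hd xs))"
    unfolding rec_fn_def
  proof (intro exI conjI allI impI)
    show "recursive_fn (Suc n) (\<lambda>xs. rec_nat (g' (tl xs)) (\<lambda>y r. h' (y # r # tl xs)) (hd xs))"
      using recursive_fn.prec[OF g'(1) h'(1)] by simp
    fix xs :: "nat list" assume xs: "length xs = Suc n"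
    have "rec_nat (g' (tl xs)) (\<lambda>y r. h' (y # r # tl xs)) k =
          rec_nat (g (tl xs)) (\<lambda>y r. h y r (tl xs)) k" for k
      by (induction k) (use xs g'(2) h'(2) in auto)
    then show "rec_nat (g' (tl xs)) (\<lambda>y r. h' (y # r # tl xs)) (hd xs) =
          rec_nat (g (tl xs)) (\<lambda>y r. h y r (tl xs)) (hd xs)" .
  qed
  from rec_fn_Cons[OF this b] show ?thesis by simp
qed

text \<open>The constructor \<open>minim\<close> accepts only regular functions, so a witness is
  required for every list of parameters.\<close>

lemma rec_fn_Least:
  assumes P: "rec_pred (Suc n) (\<lambda>xs. P (xs ! 0) (tl xs))"
    and ex: "\<And>xs. length xs = n \<Longrightarrow> \<exists>y. P y xs"
  shows "rec_fn n (\<lambda>xs. LEAST y. P y xs)"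
proof -
  \<comment> \<open>Minimization looks for a zero, so truth values are swapped: this recursion sends
    0 to 1 and every successor to 0.\<close>
  have "rec_fn (Suc n) (\<lambda>xs. rec_nat 1 (\<lambda>y r. 0) (of_bool (P (xs ! 0) (tl xs))))"
    by (rule rec_fn_rec) (use P in \<open>auto simp: rec_pred_def intro: rec_fn_const\<close>)
  then obtain g where g: "recursive_fn (n + 1) g"
    "\<And>xs. length xs = Suc n \<Longrightarrow> g xs = rec_nat 1 (\<lambda>y r. 0) (of_bool (P (xs ! 0) (tl xs)))"
    by (auto simp: rec_fn_def)
  have *: "g (y # xs) = 0 \<longleftrightarrow> P y xs" if "length xs = n" for y xs
    using g(2)[of "y # xs"] that by simp
  have "recursive_fn n (\<lambda>xs. LEAST y. g (y # xs) = 0)"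
    by (rule recursive_fn.minim) (use g * ex in auto)
  with * show ?thesis unfolding rec_fn_def by (intro exI[of _ "\<lambda>xs. LEAST y. g (y # xs) = 0"]) auto
qed

text \<open>Below nested binders a parameter appears behind one \<open>tl\<close> per binder; these
  are the resulting projections.\<close>

lemma rec_fn_tl_nth:
  "Suc i < n \<Longrightarrow> rec_fn n (\<lambda>xs. tl xs ! i)"
  "Suc (Suc i) < n \<Longrightarrow> rec_fn n (\<lambda>xs. tl (tl xs) ! i)"
  "Suc (Suc (Suc i)) < n \<Longrightarrow> rec_fn n (\<lambda>xs. tl (tl (tl xs)) ! i)"
  "Suc (Suc (Suc (Suc i))) < n \<Longrightarrow> rec_fn n (\<lambda>xs. tl (tl (tl (tl xs))) ! i)"
  subgoal by (cases n) (auto intro: rec_fn_tl rec_fn_nth)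
  subgoal by (cases n; cases "n - 1") (auto intro!: rec_fn_tl rec_fn_nth)
  subgoal by (cases n; cases "n - 1"; cases "n - 2") (auto intro!: rec_fn_tl rec_fn_nth)
  subgoal by (cases n; cases "n - 1"; cases "n - 2"; cases "n - 3") (auto intro!: rec_fn_tl rec_fn_nth)
  done

section \<open>Arithmetic and decidable predicates\<close>

lemmas rec_fn_basic = rec_fn_const rec_fn_nth rec_fn_tl_nth

lemma rec_fn_add: assumes "rec_fn n f" "rec_fn n g" shows "rec_fn n (\<lambda>xs. f xs + g xs)"
proof -
  have "rec_fn 2 (\<lambda>xs. rec_nat (xs ! 0) (\<lambda>y r. Suc r) (xs ! 1))"
    by (rule rec_fn_rec) (auto intro!: rec_fn_basic rec_fn_Suc)
  then have "rec_fn 2 (\<lambda>xs. xs ! 0 + xs ! 1)"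
  proof (rule rec_fn_cong)
    fix xs :: "nat list"
    have "rec_nat a (\<lambda>y r. Suc r) k = a + k" for a k by (induction k) auto
    then show "rec_nat (xs ! 0) (\<lambda>y r. Suc r) (xs ! 1) = xs ! 0 + xs ! 1" .
  qed
  from rec_fn_comp2[OF this assms] show ?thesis .
qed

text \<open>Inserts a dummy second argument: the terms of a sum or product ignore the accumulator
  that primitive recursion passes there.\<close>

lemma rec_fn_skip:
  assumes "rec_fn (Suc n) (\<lambda>xs. f (xs ! 0) (tl xs))"
  shows "rec_fn (Suc (Suc n)) (\<lambda>xs. f (xs ! 0) (tl (tl xs)))"
proof -
  have "rec_fn (Suc (Suc n)) (\<lambda>xs. (\<lambda>xs. f (xs ! 0) (tl xs))
      (map (\<lambda>f. f xs) ((\<lambda>xs. xs ! 0) # map (\<lambda>i xs. xs ! Suc (Suc i)) [0..<n])))"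
    by (rule rec_fn_comp) (use assms in \<open>auto intro: rec_fn_nth\<close>)
  then show ?thesis
  proof (rule rec_fn_cong)
    fix xs :: "nat list" assume "length xs = Suc (Suc n)"
    then have "map (\<lambda>f. f xs) (map (\<lambda>i xs. xs ! Suc (Suc i)) [0..<n]) = tl (tl xs)"
      by (intro nth_equalityI) (auto simp: nth_tl)
    then show "f (map (\<lambda>f. f xs) ((\<lambda>xs. xs ! 0) # map (\<lambda>i xs. xs ! Suc (Suc i)) [0..<n]) ! 0)
        (tl (map (\<lambda>f. f xs) ((\<lambda>xs. xs ! 0) # map (\<lambda>i xs. xs ! Suc (Suc i)) [0..<n]))) =
        f (xs ! 0) (tl (tl xs))" by simp
  qed
qed

lemma rec_fn_sum:
  assumes "rec_fn n b" "rec_fn (Suc n) (\<lambda>xs. f (xs ! 0) (tl xs))"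
  shows "rec_fn n (\<lambda>xs. \<Sum>y<b xs. f y xs)"
proof -
  have "rec_fn n (\<lambda>xs. rec_nat 0 (\<lambda>y r. r + f y xs) (b xs))"
  proof (rule rec_fn_rec)
    show "rec_fn (Suc (Suc n)) (\<lambda>xs. xs ! 1 + f (xs ! 0) (tl (tl xs)))"
      by (intro rec_fn_add rec_fn_nth rec_fn_skip assms) auto
  qed (use assms in \<open>auto intro: rec_fn_const\<close>)
  then show ?thesis
  proof (rule rec_fn_cong)
    fix xs
    have "rec_nat 0 (\<lambda>y r. r + f y xs) k = (\<Sum>y<k. f y xs)" for k by (induction k) auto
    then show "rec_nat 0 (\<lambda>y r. r + f y xs) (b xs) = (\<Sum>y<b xs. f y xs)" .
  qed
qed

lemma rec_fn_mult: assumes "rec_fn n f" "rec_fn n g" shows "rec_fn n (\<lambda>xs. f xs * g xs)"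
proof -
  have "rec_fn 2 (\<lambda>xs. \<Sum>y<xs ! 0. xs ! 1)"
    by (rule rec_fn_sum) (auto intro!: rec_fn_basic)
  then have "rec_fn 2 (\<lambda>xs. xs ! 0 * xs ! 1)" by simp
  from rec_fn_comp2[OF this assms] show ?thesis .
qed

lemma rec_fn_prod:
  assumes "rec_fn n b" "rec_fn (Suc n) (\<lambda>xs. f (xs ! 0) (tl xs))"
  shows "rec_fn n (\<lambda>xs. \<Prod>y<b xs. f y xs)"
proof -
  have "rec_fn n (\<lambda>xs. rec_nat 1 (\<lambda>y r. r * f y xs) (b xs))"
  proof (rule rec_fn_rec)
    show "rec_fn (Suc (Suc n)) (\<lambda>xs. xs ! 1 * f (xs ! 0) (tl (tl xs)))"
      by (intro rec_fn_mult rec_fn_nth rec_fn_skip assms) auto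
  qed (use assms in \<open>auto intro: rec_fn_const\<close>)
  then show ?thesis
  proof (rule rec_fn_cong)
    fix xs
    have "rec_nat 1 (\<lambda>y r. r * f y xs) k = (\<Prod>y<k. f y xs)" for k by (induction k) auto
    then show "rec_nat 1 (\<lambda>y r. r * f y xs) (b xs) = (\<Prod>y<b xs. f y xs)" .
  qed
qed

lemma rec_fn_power: assumes "rec_fn n f" "rec_fn n g" shows "rec_fn n (\<lambda>xs. f xs ^ g xs)"
proof -
  have "rec_fn 2 (\<lambda>xs. \<Prod>y<xs ! 1. xs ! 0)"
    by (rule rec_fn_prod) (auto intro!: rec_fn_basic)
  then have "rec_fn 2 (\<lambda>xs. xs ! 0 ^ xs ! 1)" by simp
  from rec_fn_comp2[OF this assms] show ?thesis .
qed

lemma rec_fn_diff: assumes "rec_fn n f" "rec_fn n g" shows "rec_fn n (\<lambda>xs. f xs - g xs)"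
proof -
  have "rec_fn 1 (\<lambda>xs. rec_nat 0 (\<lambda>y r. y) (xs ! 0))"
    by (rule rec_fn_rec) (auto intro!: rec_fn_basic)
  then have "rec_fn 1 (\<lambda>xs. xs ! 0 - 1)"
    by (rule rec_fn_cong) (metis diff_0_eq_0 diff_Suc_1 old.nat.simps(6,7) nat.exhaust)
  from rec_fn_comp1[OF this] have p: "rec_fn n (\<lambda>xs. f xs - 1)" if "rec_fn n f" for n f
    using that by blast
  have "rec_fn 2 (\<lambda>xs. rec_nat (xs ! 0) (\<lambda>y r. r - 1) (xs ! 1))"
    by (rule rec_fn_rec, (intro p rec_fn_basic; simp)+)
  then have "rec_fn 2 (\<lambda>xs. xs ! 0 - xs ! 1)"
  proof (rule rec_fn_cong)
    fix xs :: "nat list"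
    have "rec_nat a (\<lambda>y r. r - 1) k = a - k" for a k :: nat by (induction k) auto
    then show "rec_nat (xs ! 0) (\<lambda>y r. r - 1) (xs ! 1) = xs ! 0 - xs ! 1" .
  qed
  from rec_fn_comp2[OF this assms] show ?thesis .
qed

lemma rec_pred_le: assumes "rec_fn n f" "rec_fn n g" shows "rec_pred n (\<lambda>xs. f xs \<le> g xs)"
  unfolding rec_pred_def
  by (rule rec_fn_cong[OF rec_fn_diff[OF rec_fn_const[of n 1] rec_fn_diff[OF assms]]]) auto

lemma rec_pred_not: assumes "rec_pred n P" shows "rec_pred n (\<lambda>xs. \<not> P xs)"
  unfolding rec_pred_def
  by (rule rec_fn_cong[OF rec_fn_diff[OF rec_fn_const[of n 1] assms[unfolded rec_pred_def]]]) auto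

lemma rec_pred_conj: assumes "rec_pred n P" "rec_pred n Q" shows "rec_pred n (\<lambda>xs. P xs \<and> Q xs)"
  unfolding rec_pred_def
  by (rule rec_fn_cong[OF rec_fn_mult[OF assms[unfolded rec_pred_def]]]) auto

lemma rec_pred_cong: "rec_pred n P \<Longrightarrow> (\<And>xs. length xs = n \<Longrightarrow> P xs \<longleftrightarrow> Q xs) \<Longrightarrow> rec_pred n Q"
  unfolding rec_pred_def by (erule rec_fn_cong) simp

lemma rec_pred_imp: assumes "rec_pred n P" "rec_pred n Q" shows "rec_pred n (\<lambda>xs. P xs \<longrightarrow> Q xs)"
  by (rule rec_pred_cong[OF rec_pred_not[OF rec_pred_conj[OF assms(1) rec_pred_not[OF assms(2)]]]]) auto

lemma rec_pred_less: assumes "rec_fn n f" "rec_fn n g" shows "rec_pred n (\<lambda>xs. f xs < g xs)"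
  by (rule rec_pred_cong[OF rec_pred_not[OF rec_pred_le[OF assms(2,1)]]]) auto

lemma rec_pred_eq: assumes "rec_fn n f" "rec_fn n g" shows "rec_pred n (\<lambda>xs. f xs = g xs)"
  by (rule rec_pred_cong[OF rec_pred_conj[OF rec_pred_le[OF assms] rec_pred_le[OF assms(2,1)]]]) auto

lemma rec_pred_all_less:
  assumes "rec_fn n b" "rec_pred (Suc n) (\<lambda>xs. P (xs ! 0) (tl xs))"
  shows "rec_pred n (\<lambda>xs. \<forall>y<b xs. P y xs)"
  unfolding rec_pred_def
  by (rule rec_fn_cong[OF rec_fn_prod[where f = "\<lambda>y xs. of_bool (P y xs)",
        OF assms(1) assms(2)[unfolded rec_pred_def]]]) (auto simp: prod_zero_iff)

lemma rec_fn_of_bool: "rec_pred n P \<Longrightarrow> rec_fn n (\<lambda>xs. of_bool (P xs))"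
  by (simp add: rec_pred_def)

lemma rec_fn_if: assumes "rec_pred n P" "rec_fn n f" "rec_fn n g"
  shows "rec_fn n (\<lambda>xs. if P xs then f xs else g xs)"
  by (rule rec_fn_cong[OF rec_fn_add[OF rec_fn_mult[OF rec_fn_of_bool[OF assms(1)] assms(2)]
      rec_fn_mult[OF rec_fn_of_bool[OF rec_pred_not[OF assms(1)]] assms(3)]]]) auto

lemma rec_fn_div: assumes "rec_fn n f" "rec_fn n g" shows "rec_fn n (\<lambda>xs. f xs div g xs)"
proof -
  \<comment> \<open>The quotient counts the positive multiples of the divisor up to the dividend.
    The conjunct \<open>0 < xs ! 1\<close> makes a zero divisor give 0, as \<open>div\<close>
    does.\<close>
  have "rec_fn 2 (\<lambda>xs. \<Sum>y<xs ! 0. of_bool (0 < xs ! 1 \<and> Suc y * xs ! 1 \<le> xs ! 0))"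
    by (intro rec_fn_sum rec_fn_of_bool rec_pred_conj rec_pred_le rec_pred_less rec_fn_mult rec_fn_Suc rec_fn_basic)
      auto
  then have "rec_fn 2 (\<lambda>xs. xs ! 0 div xs ! 1)"
  proof (rule rec_fn_cong)
    fix xs :: "nat list"
    have "(\<Sum>y<a. of_bool (0 < b \<and> Suc y * b \<le> a)) = a div b" for a b :: nat
    proof (cases "b = 0")
      case False
      have "Suc y * b \<le> a \<longleftrightarrow> y < a div b" for y
        using False less_eq_div_iff_mult_less_eq[of b "Suc y" a] by auto
      moreover have "{..<a} \<inter> {y. y < a div b} = {..<a div b}"
        using div_le_dividend[of a b] by (auto intro: less_le_trans)
      ultimately show ?thesis using False by (simp add: of_bool_def sum.If_cases)
    qed simp
    then show "(\<Sum>y<xs ! 0. of_bool (0 < xs ! 1 \<and> Suc y * xs ! 1 \<le> xs ! 0)) = xs ! 0 div xs ! 1" .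
  qed
  from rec_fn_comp2[OF this assms] show ?thesis .
qed

lemma rec_fn_mod: assumes "rec_fn n f" "rec_fn n g" shows "rec_fn n (\<lambda>xs. f xs mod g xs)"
  by (rule rec_fn_cong[OF rec_fn_diff[OF assms(1) rec_fn_mult[OF rec_fn_div[OF assms] assms(2)]]])
    (simp add: minus_div_mult_eq_mod)

section \<open>Pairing and its inverse\<close>

lemma rec_fn_prod_encode: assumes "rec_fn n f" "rec_fn n g" shows "rec_fn n (\<lambda>xs. prod_encode (f xs, g xs))"
proof -
  have "rec_fn n (\<lambda>xs. (f xs + g xs) * Suc (f xs + g xs) div 2 + f xs)"
    by (intro rec_fn_add rec_fn_div rec_fn_mult rec_fn_Suc rec_fn_const assms)
  then show ?thesis by (simp add: prod_encode_def triangle_def)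
qed

abbreviation pfst :: "nat \<Rightarrow> nat" where "pfst z \<equiv> fst (prod_decode z)"
abbreviation psnd :: "nat \<Rightarrow> nat" where "psnd z \<equiv> snd (prod_decode z)"

text \<open>Both components of a pair are at most its code, so a bounded double sum finds the unique
  pair. This makes the projections recursive without inverting the triangular numbers
  explicitly.\<close>

lemma sum_prod_decode:
  "(\<Sum>x<Suc z. \<Sum>y<Suc z. of_bool (prod_encode (x, y) = z) * h x y) = h (pfst z) (psnd z)"
  for h :: "nat \<Rightarrow> nat \<Rightarrow> nat"
proof -
  obtain a b where ab: "prod_decode z = (a, b)" by (cases "prod_decode z")
  then have z: "z = prod_encode (a, b)" by (metis prod_decode_inverse)
  have le: "a \<le> z" "b \<le> z" using le_prod_encode_1 le_prod_encode_2 z by auto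
  have "(\<Sum>x<Suc z. \<Sum>y<Suc z. of_bool (prod_encode (x, y) = z) * h x y) =
      (\<Sum>x<Suc z. \<Sum>y<Suc z. if y = b then if x = a then h x y else 0 else 0)"
    by (intro sum.cong) (auto simp: z prod_encode_eq)
  also have "\<dots> = h a b" using le by (simp add: sum.delta)
  finally show ?thesis by (simp add: ab)
qed

lemma rec_fn_pfst: assumes "rec_fn n f" shows "rec_fn n (\<lambda>xs. pfst (f xs))"
proof -
  have "rec_fn 1 (\<lambda>xs. \<Sum>x<Suc (xs ! 0). \<Sum>y<Suc (xs ! 0). of_bool (prod_encode (x, y) = xs ! 0) * x)"
    by (intro rec_fn_sum rec_fn_of_bool rec_pred_eq rec_fn_prod_encode rec_fn_mult rec_fn_Suc rec_fn_basic) auto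
  then have "rec_fn 1 (\<lambda>xs. pfst (xs ! 0))" by (simp only: sum_prod_decode)
  from rec_fn_comp1[OF this assms] show ?thesis .
qed

lemma rec_fn_psnd: assumes "rec_fn n f" shows "rec_fn n (\<lambda>xs. psnd (f xs))"
proof -
  have "rec_fn 1 (\<lambda>xs. \<Sum>x<Suc (xs ! 0). \<Sum>y<Suc (xs ! 0). of_bool (prod_encode (x, y) = xs ! 0) * y)"
    by (intro rec_fn_sum rec_fn_of_bool rec_pred_eq rec_fn_prod_encode rec_fn_mult rec_fn_Suc rec_fn_basic) auto
  then have "rec_fn 1 (\<lambda>xs. psnd (xs ! 0))" by (simp only: sum_prod_decode)
  from rec_fn_comp1[OF this assms] show ?thesis .
qed

lemmas rec_fn_intros = rec_fn_sum rec_fn_prod rec_fn_add rec_fn_mult rec_fn_power rec_fn_diff rec_fn_div rec_fn_mod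
  rec_fn_prod_encode rec_fn_pfst rec_fn_psnd rec_fn_if rec_fn_of_bool rec_fn_Suc rec_fn_basic
  rec_pred_le rec_pred_less rec_pred_eq rec_pred_not rec_pred_conj rec_pred_imp rec_pred_all_less

section \<open>Numbering sites and configurations\<close>

text \<open>On lists of one fixed positive length this is a bijection onto the naturals, whereas the
  values of \<open>list_encode\<close> on such lists leave gaps. Every number then names a site and
  no validity test is needed.\<close>

fun pack :: "nat list \<Rightarrow> nat" where
  "pack [] = 0"
| "pack [x] = x"
| "pack (x # y # ys) = prod_encode (x, pack (y # ys))"

fun unpack :: "nat \<Rightarrow> nat \<Rightarrow> nat list" where
  "unpack 0 k = [k]"
| "unpack (Suc d) k = pfst k # unpack d (psnd k)"

lemma length_unpack [simp]: "length (unpack d k) = Suc d"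
  by (induction d arbitrary: k) auto

lemma pack_unpack [simp]: "pack (unpack d k) = k"
proof (induction d arbitrary: k)
  case (Suc d)
  obtain y ys where *: "unpack d (psnd k) = y # ys"
    by (metis length_unpack length_Suc_conv)
  have "pack (y # ys) = psnd k" using Suc[of "psnd k"] * by simp
  then show ?case by (simp add: *)
qed simp

lemma unpack_pack: "length xs = Suc d \<Longrightarrow> unpack d (pack xs) = xs"
proof (induction d arbitrary: xs)
  case 0 then show ?case by (auto simp: length_Suc_conv)
next
  case (Suc d)
  then obtain x y ys where "xs = x # y # ys" by (metis length_Suc_conv)
  with Suc show ?case by simp
qed

lemma coords: "distinct (coords :: 'd::finite list)" "set (coords :: 'd list) = UNIV"
proof -
  have "\<exists>is. distinct is \<and> set is = (UNIV :: 'd set)"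
    using finite_distinct_list[of "UNIV :: 'd set"] by auto
  from someI_ex[OF this] show "distinct (coords :: 'd list)" "set (coords :: 'd list) = UNIV"
    by (auto simp: coords_def)
qed

lemma length_coords: "length (coords :: 'd::finite list) = Suc (CARD('d) - 1)"
  using distinct_card[of "coords :: 'd list"] coords[where 'd = 'd]
    zero_less_card_finite[where 'a = 'd] by simp

definition idx :: "'d::finite site \<Rightarrow> nat" where
  "idx s = pack (map (\<lambda>i. int_encode (s $ i)) coords)"

lemma bij_idx: "bij (idx :: 'd::finite site \<Rightarrow> nat)"
proof (rule bijI)
  show "inj (idx :: 'd site \<Rightarrow> nat)"
  proof (rule injI)
    fix s t :: "'d site" assume "idx s = idx t"
    then have "map (\<lambda>i. int_encode (s $ i)) coords = map (\<lambda>i. int_encode (t $ i)) coords"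
      unfolding idx_def using unpack_pack length_coords by (metis length_map)
    then show "s = t" using coords(2)[where 'd = 'd] by (auto simp: vec_eq_iff int_encode_eq)
  qed
  show "surj (idx :: 'd site \<Rightarrow> nat)"
  proof (rule surjI)
    fix k
    let ?u = "unpack (CARD('d) - 1) k"
    let ?s = "(\<chi> i. int_decode (the (map_of (zip coords ?u) i))) :: 'd site"
    have "map (\<lambda>i. int_encode (?s $ i)) coords = ?u"
      using coords(1)[where 'd = 'd] length_coords[where 'd = 'd]
      by (intro nth_equalityI) (auto simp: map_of_zip_nth)
    then show "idx ?s = k" by (simp add: idx_def)
  qed
qed

definition site_at :: "nat \<Rightarrow> 'd::finite site" where "site_at = inv idx"

lemma idx_site_at [simp]: "idx (site_at k) = k"
  unfolding site_at_def by (rule surj_f_inv_f[OF bij_is_surj[OF bij_idx]])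

lemma site_at_idx [simp]: "site_at (idx s) = s"
  unfolding site_at_def by (rule inv_f_f[OF bij_is_inj[OF bij_idx]])

text \<open>Turns \<^const>\<open>site_code\<close>, which is not surjective, into the bijective numbering \<^const>\<open>idx\<close>;
  the first argument is the dimension minus one.\<close>

fun idx_of_code :: "nat \<Rightarrow> nat \<Rightarrow> nat" where
  "idx_of_code 0 c = pfst (c - 1)"
| "idx_of_code (Suc d) c = prod_encode (pfst (c - 1), idx_of_code d (psnd (c - 1)))"

text \<open>\<open>list_encode\<close> of a nonempty list is the successor of a pair, which explains
  each \<open>c - 1\<close>; at the last entry the code of the empty tail is dropped.\<close>

lemma idx_of_code_list_encode: "length xs = Suc d \<Longrightarrow> idx_of_code d (list_encode xs) = pack xs"
proof (induction d arbitrary: xs)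
  case 0 then show ?case by (auto simp: length_Suc_conv)
next
  case (Suc d)
  then obtain x y ys where "xs = x # y # ys" by (metis length_Suc_conv)
  with Suc show ?case by (simp del: list_encode.simps(2) add: list_encode.simps(2)[of x])
qed

lemma idx_of_code_site_code: "idx_of_code (CARD('d) - 1) (site_code s) = idx s" for s :: "'d::finite site"
  unfolding site_code_def idx_def by (rule idx_of_code_list_encode) (simp add: length_coords)

lemma rec_fn_idx_of_code: "rec_fn n f \<Longrightarrow> rec_fn n (\<lambda>xs. idx_of_code d (f xs))"
proof (induction d arbitrary: f)
  case (Suc d)
  have "rec_fn n (\<lambda>xs. psnd (f xs - 1))" by (intro rec_fn_intros Suc.prems)
  from Suc.IH[OF this] show ?case
    unfolding idx_of_code.simps by (intro rec_fn_intros Suc.prems)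
qed (auto intro!: rec_fn_intros)

section \<open>Translation of sites by a fixed vector\<close>

definition add_int_code :: "int \<Rightarrow> nat \<Rightarrow> nat" where
  "add_int_code v k = int_encode (int_decode k + v)"

text \<open>The offset \<open>v\<close> is fixed, so induction on it composes unit steps. Even codes
  stand for nonnegative and odd codes for negative integers, and a unit step moves the code by 2
  except between -1 and 0. Upwards, truncated subtraction sends code 1 to 0 as required; downwards,
  code 0 has its own case.\<close>

lemma rec_fn_add_int_code: "rec_fn n f \<Longrightarrow> rec_fn n (\<lambda>xs. add_int_code v (f xs))"
proof (induction v arbitrary: f rule: int_induct[of _ 0])
  case base then show ?case by (simp add: add_int_code_def)
next
  case (step1 v)
  have "add_int_code 1 k = (if k mod 2 = 0 then k + 2 else k - 2)" for k
  proof (cases "even k")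
    case False
    then obtain j where "k = 2 * j + 1" by (elim oddE)
    then show ?thesis
      by (cases j) (auto simp: add_int_code_def int_encode_def int_decode_def sum_encode_def sum_decode_def)
  qed (auto simp: add_int_code_def int_encode_def int_decode_def sum_encode_def sum_decode_def
      nat_add_distrib)
  then have "add_int_code (v + 1) k = (if add_int_code v k mod 2 = 0 then add_int_code v k + 2 else add_int_code v k - 2)" for k
    by (metis add_int_code_def add.assoc int_encode_inverse)
  then show ?case using step1 by (auto intro!: rec_fn_intros)
next
  case (step2 v)
  have "add_int_code (- 1) k = (if k = 0 then 1 else if k mod 2 = 0 then k - 2 else k + 2)" for k
  proof (cases "even k")
    case True
    then obtain j where "k = 2 * j" by (elim evenE)
    then show ?thesis
      by (cases j) (auto simp: add_int_code_def int_encode_def int_decode_def sum_encode_def sum_decode_def)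
  next
    case False
    then obtain j where "k = 2 * j + 1" by (elim oddE)
    then show ?thesis
      by (auto simp: add_int_code_def int_encode_def int_decode_def sum_encode_def sum_decode_def
          nat_add_distrib)
  qed
  then have "add_int_code (v - 1) k = (if add_int_code v k = 0 then 1
      else if add_int_code v k mod 2 = 0 then add_int_code v k - 2 else add_int_code v k + 2)" for k
    by (metis add_int_code_def add.assoc int_encode_inverse uminus_add_conv_diff diff_conv_add_uminus)
  then show ?case using step2 by (auto intro!: rec_fn_intros)
qed

fun add_offsets :: "int list \<Rightarrow> nat \<Rightarrow> nat" where
  "add_offsets [] k = k"
| "add_offsets [v] k = add_int_code v k"
| "add_offsets (v # w # vs) k = prod_encode (add_int_code v (pfst k), add_offsets (w # vs) (psnd k))"

lemma rec_fn_add_offsets: "rec_fn n f \<Longrightarrow> rec_fn n (\<lambda>xs. add_offsets vs (f xs))"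
proof (induction vs arbitrary: f rule: induct_list012)
  case (3 v w vs)
  from 3(2)[OF rec_fn_psnd[OF 3(3)]] show ?case
    unfolding add_offsets.simps by (intro rec_fn_intros rec_fn_add_int_code 3)
qed (auto intro!: rec_fn_add_int_code)

lemma add_offsets_pack: "length vs = length xs \<Longrightarrow> add_offsets vs (pack xs) = pack (map2 add_int_code vs xs)"
  by (induction xs arbitrary: vs rule: pack.induct) (auto simp: length_Suc_conv)

definition site_shift :: "'d::finite site \<Rightarrow> nat \<Rightarrow> nat" where
  "site_shift v = add_offsets (map (\<lambda>i. v $ i) coords)"

lemma site_at_site_shift: "site_at (site_shift v k) = site_at k + v"
proof -
  have "site_shift v (idx s) = idx (s + v)" for s :: "'a site"
    unfolding site_shift_def idx_def
    by (simp add: add_offsets_pack map2_map_map add_int_code_def)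
  from this[of "site_at k"] have "site_shift v k = idx (site_at k + v)" by simp
  then show ?thesis by simp
qed

lemma rec_fn_site_shift: "rec_fn n f \<Longrightarrow> rec_fn n (\<lambda>xs. site_shift v (f xs))"
  unfolding site_shift_def by (rule rec_fn_add_offsets)

section \<open>Finite windows as numbers written in base \<open>CARD('s)\<close>\<close>

text \<open>\<open>to_nat\<close> is merely an injection; base \<open>CARD('s)\<close> digits call
  for a numbering onto exactly the numbers below \<open>CARD('s)\<close>.\<close>

definition letter_idx :: "'s::finite \<Rightarrow> nat" where
  "letter_idx = (SOME h. bij_betw h UNIV {..<CARD('s)})"

definition letter :: "nat \<Rightarrow> 's::finite" where
  "letter = inv_into UNIV letter_idx"

lemma bij_letter_idx: "bij_betw (letter_idx :: 's::finite \<Rightarrow> nat) UNIV {..<CARD('s)}"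
proof -
  have "\<exists>h. bij_betw h (UNIV :: 's set) {..<CARD('s)}"
    by (rule finite_same_card_bij) auto
  from someI_ex[OF this] show ?thesis by (simp add: letter_idx_def)
qed

lemma letter_idx_less [simp]: "letter_idx (s :: 's::finite) < CARD('s)"
  using bij_letter_idx by (auto simp: bij_betw_def)

lemma letter_letter_idx [simp]: "letter (letter_idx s) = s"
  unfolding letter_def by (rule inv_into_f_f[OF bij_betw_imp_inj_on[OF bij_letter_idx]]) simp

lemma letter_idx_letter [simp]: "j < CARD('s) \<Longrightarrow> letter_idx (letter j :: 's::finite) = j"
  using bij_letter_idx[where 's = 's] unfolding letter_def bij_betw_def by (intro f_inv_into_f) auto

definition digit :: "nat \<Rightarrow> nat \<Rightarrow> nat \<Rightarrow> nat" where
  "digit b X k = X div b ^ k mod b"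

lemma rec_fn_digit:
  "rec_fn n b \<Longrightarrow> rec_fn n f \<Longrightarrow> rec_fn n g \<Longrightarrow> rec_fn n (\<lambda>xs. digit (b xs) (f xs) (g xs))"
  unfolding digit_def by (intro rec_fn_intros)

lemma digit_less [simp]: "0 < b \<Longrightarrow> digit b X k < b"
  by (simp add: digit_def)

lemma mod_power_eq_sum_digit: "X mod b ^ L = (\<Sum>k<L. digit b X k * b ^ k)"
proof (induction L)
  case (Suc L)
  have "X mod b ^ Suc L = b ^ L * digit b X L + X mod b ^ L"
    unfolding digit_def power_Suc2 by (rule mod_mult2_eq)
  with Suc show ?case by simp
qed simp

lemma sum_digits_less: "(\<And>k. k < L \<Longrightarrow> c k < b) \<Longrightarrow> (\<Sum>k<L. c k * b ^ k) < b ^ L" for b :: nat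
proof (induction L)
  case (Suc L)
  have "c L * b ^ L + b ^ L \<le> b * b ^ L"
    using Suc.prems[of L] mult_le_mono1[of "Suc (c L)" b "b ^ L"] by simp
  with Suc show ?case by fastforce
qed simp

lemma digit_sum:
  assumes "\<And>k. k < L \<Longrightarrow> c k < b" "k < L"
  shows "digit b (\<Sum>k<L. c k * b ^ k) k = c k"
  using assms
proof (induction L)
  case (Suc L)
  let ?D = "\<Sum>k<L. c k * b ^ k"
  have D: "?D < b ^ L" by (rule sum_digits_less) (use Suc.prems in auto)
  have b: "0 < b" using Suc.prems(1)[of 0] by simp
  show ?case
  proof (cases "k = L")
    case True
    then show ?thesis using D b Suc.prems(1)[of L] by (simp add: digit_def)
  next
    case False
    then have k: "k < L" using Suc.prems by simp
    then have "b ^ L = b ^ k * (b * b ^ (L - Suc k))"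
      by (simp flip: power_Suc power_add)
    then have eq: "c L * b ^ L = b ^ k * (b * (c L * b ^ (L - Suc k)))" by (simp only: mult_ac)
    have "(?D + c L * b ^ L) div b ^ k = b * (c L * b ^ (L - Suc k)) + ?D div b ^ k"
      unfolding eq by (rule div_mult_self2) (use b in simp)
    then show ?thesis using Suc k by (simp add: digit_def)
  qed
qed simp

definition code_of :: "nat \<Rightarrow> ('d::finite, 's::finite) config \<Rightarrow> nat" where
  "code_of L x = (\<Sum>k<L. letter_idx (x (site_at k)) * CARD('s) ^ k)"

text \<open>All digits of \<open>X\<close> far enough out are 0, so outside a finite window the
  configuration is filled with \<open>letter 0\<close>. Being total, it lets local functions be
  evaluated directly on codes.\<close>

definition config_of :: "nat \<Rightarrow> ('d::finite, 's::finite) config" where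
  "config_of X = (\<lambda>s. letter (digit CARD('s) X (idx s)))"

lemma code_of_less: "code_of L (x :: ('d::finite, 's::finite) config) < CARD('s) ^ L"
  unfolding code_of_def by (rule sum_digits_less) simp

lemma digit_code_of: "k < L \<Longrightarrow> digit CARD('s) (code_of L x) k = letter_idx (x (site_at k))"
  for x :: "('d::finite, 's::finite) config"
  unfolding code_of_def by (rule digit_sum) simp_all

lemma config_of_site_at: "config_of X (site_at k) = (letter (digit CARD('s) X k) :: 's::finite)"
  by (simp add: config_of_def)

lemma code_of_config_of: "code_of L (config_of X :: ('d::finite, 's::finite) config) = X mod CARD('s) ^ L"
  by (simp add: code_of_def config_of_site_at mod_power_eq_sum_digit)

lemma config_of_code_of: "k < L \<Longrightarrow> config_of (code_of L x) (site_at k) = x (site_at k)"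
  by (simp add: config_of_site_at digit_code_of)

lemma code_of_eq_iff: "code_of L x = code_of L y \<longleftrightarrow> (\<forall>k<L. x (site_at k) = y (site_at k))"
proof
  show "code_of L x = code_of L y \<Longrightarrow> \<forall>k<L. x (site_at k) = y (site_at k)" by (metis config_of_code_of)
qed (simp add: code_of_def)

lemma code_of_eq_iff': "Y < CARD('s) ^ L \<Longrightarrow> code_of L x = Y \<longleftrightarrow> (\<forall>k<L. x (site_at k) = letter (digit CARD('s) Y k))"
  for x :: "('d::finite, 's::finite) config"
  using code_of_eq_iff[of L x "config_of Y"] by (simp add: code_of_config_of config_of_site_at)

section \<open>Local functions\<close>

text \<open>Windows are initial segments of the numbering of sites. They are linearly ordered, so
  finitely many local functions always share a window.\<close>

definition depends_on :: "nat \<Rightarrow> (('d::finite, 's::finite) config \<Rightarrow> 'b) \<Rightarrow> bool" where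
  "depends_on L f \<longleftrightarrow> (\<forall>x y. (\<forall>k<L. x (site_at k) = y (site_at k)) \<longrightarrow> f x = f y)"

definition local_fn :: "(('d::finite, 's::finite) config \<Rightarrow> 'b) \<Rightarrow> bool" where
  "local_fn f \<longleftrightarrow> (\<exists>L. depends_on L f)"

lemma depends_on_mono: "depends_on L f \<Longrightarrow> L \<le> M \<Longrightarrow> depends_on M f"
  unfolding depends_on_def using less_le_trans by blast

lemma depends_on_code_of: "depends_on L f \<Longrightarrow> code_of L x = code_of L y \<Longrightarrow> f x = f y"
  unfolding depends_on_def code_of_eq_iff by blast

lemma depends_on_config_of: "depends_on L f \<Longrightarrow> f (config_of (code_of L x)) = f x"
  unfolding depends_on_def using config_of_code_of by metis

lemma depends_on_code_of_fn: "depends_on L (\<lambda>x. h (code_of L x))"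
  unfolding depends_on_def by (metis code_of_eq_iff)

lemma local_fn_const: "local_fn (\<lambda>x. c)"
  by (simp add: local_fn_def depends_on_def)

lemma local_fn_comp: "local_fn f \<Longrightarrow> local_fn (\<lambda>x. h (f x))"
  unfolding local_fn_def depends_on_def by metis

lemma local_fn_comp2: assumes "local_fn f" "local_fn g" shows "local_fn (\<lambda>x. h (f x) (g x))"
proof -
  obtain L M where "depends_on L f" "depends_on M g" using assms by (auto simp: local_fn_def)
  then have "depends_on (max L M) f" "depends_on (max L M) g"
    by (auto intro: depends_on_mono)
  then have "depends_on (max L M) (\<lambda>x. h (f x) (g x))"
    unfolding depends_on_def by metis
  then show ?thesis by (auto simp: local_fn_def)
qed

lemma local_fn_sum: "(\<And>i. i \<in> A \<Longrightarrow> local_fn (f i)) \<Longrightarrow> local_fn (\<lambda>x. \<Sum>i\<in>A. f i x)"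
  by (induction A rule: infinite_finite_induct) (auto intro: local_fn_const local_fn_comp2)

lemma local_fn_bounded:
  fixes f :: "('d::finite, 's::finite) config \<Rightarrow> real"
  assumes "local_fn f"
  shows "\<exists>C. \<forall>x. \<bar>f x\<bar> \<le> C"
proof -
  obtain L where L: "depends_on L f" using assms by (auto simp: local_fn_def)
  have "\<bar>f x\<bar> \<le> (\<Sum>Y<CARD('s)^L. \<bar>f (config_of Y)\<bar>)" for x
    using member_le_sum[of "code_of L x" "{..<CARD('s)^L}" "\<lambda>Y. \<bar>f (config_of Y)\<bar>"]
    by (simp add: code_of_less depends_on_config_of[OF L])
  then show ?thesis by blast
qed

lemma depends_on_expand:
  fixes f :: "('d::finite, 's::finite) config \<Rightarrow> real"
  assumes "depends_on L f"
  shows "f x = (\<Sum>Y<CARD('s)^L. f (config_of Y) * indicator {x. code_of L x = Y} x)"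
proof -
  have "(\<Sum>Y<CARD('s)^L. f (config_of Y) * indicator {x. code_of L x = Y} x) =
    (\<Sum>Y<CARD('s)^L. if Y = code_of L x then f (config_of Y) else 0)"
    by (intro sum.cong) auto
  also have "\<dots> = f x" by (simp add: sum.delta code_of_less depends_on_config_of[OF assms])
  finally show ?thesis by simp
qed

section \<open>Borel structure and integration of local functions\<close>

lemma topspace_config [simp]: "topspace config_topology = UNIV"
  by (simp add: config_topology_def)

text \<open>Any finite set of sites lies in an initial segment, so the cylinders over initial
  segments form a base.\<close>

lemma openin_config_iff:
  "openin config_topology (U :: ('d::finite, 's::finite) config set) \<longleftrightarrow>
    (\<forall>x\<in>U. \<exists>L. {y. code_of L y = code_of L x} \<subseteq> U)"
proof (intro iffI ballI)
  fix x assume U: "openin config_topology U" "x \<in> U"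
  then obtain V where V: "finite {i. V i \<noteq> UNIV}" "x \<in> Pi\<^sub>E UNIV V" "Pi\<^sub>E UNIV V \<subseteq> U"
    unfolding config_topology_def openin_product_topology_alt by auto
  from V(1) have "finite (idx ` {i. V i \<noteq> UNIV})" by simp
  then obtain L where L: "\<And>i. V i \<noteq> UNIV \<Longrightarrow> idx i < L"
    unfolding finite_nat_set_iff_bounded by auto
  have "{y. code_of L y = code_of L x} \<subseteq> Pi\<^sub>E UNIV V"
  proof safe
    fix y :: "('d, 's) config" and s :: "'d site" assume "code_of L y = code_of L x"
    then have "idx s < L \<Longrightarrow> y s = x s" unfolding code_of_eq_iff using site_at_idx by metis
    then show "y s \<in> V s" using L[of s] V(2) by (cases "V s = UNIV") (auto simp: PiE_iff)
  qed auto
  with V(3) show "\<exists>L. {y. code_of L y = code_of L x} \<subseteq> U" by blast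
next
  assume *: "\<forall>x\<in>U. \<exists>L. {y. code_of L y = code_of L x} \<subseteq> U"
  show "openin config_topology U"
    unfolding config_topology_def openin_product_topology_alt
  proof
    fix x assume "x \<in> U"
    with * obtain L where L: "{y. code_of L y = code_of L x} \<subseteq> U" by blast
    let ?V = "\<lambda>s. if idx s < L then {x s} else UNIV"
    have "{i. ?V i \<noteq> UNIV} \<subseteq> site_at ` {..<L}" 
    proof
      fix i assume "i \<in> {i. ?V i \<noteq> UNIV}"
      then have "idx i < L" by (auto split: if_splits)
      then show "i \<in> site_at ` {..<L}" by (intro image_eqI[of _ _ "idx i"]) auto
    qed
    then have "finite {i. ?V i \<noteq> UNIV}" using finite_surj by blast
    moreover have "x \<in> Pi\<^sub>E UNIV ?V" by auto
    moreover have "Pi\<^sub>E UNIV ?V \<subseteq> {y. code_of L y = code_of L x}"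
    proof
      fix y assume y: "y \<in> Pi\<^sub>E UNIV ?V"
      have "y (site_at k) = x (site_at k)" if "k < L" for k
        using PiE_mem[OF y, of "site_at k"] that by simp
      then show "y \<in> {y. code_of L y = code_of L x}" by (simp add: code_of_eq_iff)
    qed
    ultimately show "\<exists>V. finite {i \<in> UNIV. V i \<noteq> topspace (discrete_topology UNIV)} \<and>
        (\<forall>i\<in>UNIV. openin (discrete_topology UNIV) (V i)) \<and> x \<in> Pi\<^sub>E UNIV V \<and> Pi\<^sub>E UNIV V \<subseteq> U"
      using L by (intro exI[of _ ?V]) auto
  qed
qed

definition local_sets :: "('d::finite, 's::finite) config set set" where
  "local_sets = {A. local_fn (\<lambda>x. x \<in> A)}"

lemma local_sets_open:
  assumes "A \<in> local_sets"
  shows "openin config_topology A"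
  unfolding openin_config_iff
proof
  fix x assume x: "x \<in> A"
  obtain L where L: "depends_on L (\<lambda>x. x \<in> A)"
    using assms by (auto simp: local_sets_def local_fn_def)
  have "{y. code_of L y = code_of L x} \<subseteq> A"
    using depends_on_code_of[OF L] x by blast
  then show "\<exists>L. {y. code_of L y = code_of L x} \<subseteq> A" ..
qed

lemma local_sets_closed: "A \<in> local_sets \<Longrightarrow> closedin config_topology A"
  using local_sets_open[of "- A"] local_fn_comp[of "\<lambda>x. x \<in> A" Not]
  by (simp add: closedin_def local_sets_def Compl_eq_Diff_UNIV)

lemma code_of_local_sets: "{x. code_of L x = Y} \<in> local_sets"
  unfolding local_sets_def local_fn_def using depends_on_code_of_fn[of L "\<lambda>c. c = Y"] by auto

lemma space_config_borel [simp]: "space config_borel = UNIV"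
  by (simp add: config_borel_def space_measure_of_conv)

text \<open>An open set is the union of the basic cylinders it contains. These are indexed by pairs
  of naturals, so the union is countable.\<close>

lemma sets_config_borel:
  "sets (config_borel :: ('d::finite, 's::finite) config measure) = sigma_sets UNIV local_sets"
proof -
  have "sigma_sets UNIV {U :: ('d, 's) config set. openin config_topology U} = sigma_sets UNIV local_sets"
  proof (rule sigma_sets_eqI)
    fix U :: "('d, 's) config set" assume U: "U \<in> {U. openin config_topology U}"
    let ?I = "{(L, Y). {y. code_of L y = Y} \<subseteq> U}"
    have "U = (\<Union>(L, Y)\<in>?I. {y. code_of L y = Y})"
    proof (intro subset_antisym subsetI)
      fix x assume "x \<in> U"
      then obtain L where "{y. code_of L y = code_of L x} \<subseteq> U"
        using U unfolding mem_Collect_eq openin_config_iff by blast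
      then show "x \<in> (\<Union>(L, Y)\<in>?I. {y. code_of L y = Y})"
        by (intro UN_I[of "(L, code_of L x)"]) auto
    qed auto
    also have "\<dots> \<in> sigma_sets UNIV local_sets"
    proof (rule sigma_sets_UNION)
      show "countable ((\<lambda>(L, Y). {y :: ('d, 's) config. code_of L y = Y}) ` ?I)" by auto
    qed (use code_of_local_sets in auto)
    finally show "U \<in> sigma_sets UNIV local_sets" .
  qed (auto dest: local_sets_open)
  then show ?thesis by (simp add: config_borel_def sets_measure_of_conv)
qed

lemma local_sets_sets: "A \<in> local_sets \<Longrightarrow> A \<in> sets config_borel"
  by (simp add: sets_config_borel)

lemma algebra_local_sets: "algebra UNIV local_sets"
  unfolding algebra_iff_Un local_sets_def
  by (auto intro: local_fn_const local_fn_comp local_fn_comp2)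

lemma measure_eqI_local_sets:
  assumes "prob_space M" "sets M = sets config_borel" "sets N = sets config_borel"
    and "\<And>A. A \<in> local_sets \<Longrightarrow> emeasure M A = emeasure N A"
  shows "M = N"
proof (rule measure_eqI_generator_eq)
  show "Int_stable local_sets"
    unfolding Int_stable_def local_sets_def by (auto intro: local_fn_comp2)
  show "range (\<lambda>i. UNIV) \<subseteq> local_sets" by (auto simp: local_sets_def local_fn_const)
  interpret prob_space M by fact
  show "emeasure M UNIV \<noteq> \<infinity>" by simp
qed (use assms in \<open>auto simp: sets_config_borel\<close>)

lemma
  fixes f :: "('d::finite, 's::finite) config \<Rightarrow> real"
  assumes M: "prob_space M" "sets M = sets config_borel" and f: "depends_on L f"
  shows integrable_depends_on: "integrable M f"
    and integral_depends_on:
      "integral\<^sup>L M f = (\<Sum>Y<CARD('s)^L. f (config_of Y) * measure M {x. code_of L x = Y})"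
proof -
  interpret prob_space M by fact
  have sp: "space M = UNIV" using sets_eq_imp_space_eq[OF M(2)] by simp
  have *: "{x. code_of L x = Y} \<in> sets M" for Y using M(2) code_of_local_sets local_sets_sets by blast
  have eq: "f = (\<lambda>x. \<Sum>Y<CARD('s)^L. f (config_of Y) * indicator {x. code_of L x = Y} x)"
    using depends_on_expand[OF f] by blast
  have int: "integrable M (\<lambda>x. f (config_of Y) * indicator {x. code_of L x = Y} x)" for Y
    using * by (intro integrable_mult_right integrable_real_indicator) (auto simp: emeasure_eq_measure)
  show "integrable M f" by (subst eq) (intro Bochner_Integration.integrable_sum int)
  show "integral\<^sup>L M f = (\<Sum>Y<CARD('s)^L. f (config_of Y) * measure M {x. code_of L x = Y})"
    by (subst eq, subst Bochner_Integration.integral_sum[OF int]) (use * in \<open>simp add: sp\<close>)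
qed

lemma integrable_local_fn:
  fixes f :: "('d::finite, 's::finite) config \<Rightarrow> real"
  shows "prob_space M \<Longrightarrow> sets M = sets config_borel \<Longrightarrow> local_fn f \<Longrightarrow> integrable M f"
  unfolding local_fn_def using integrable_depends_on by blast

lemma compact_space_config: "compact_space (config_topology :: ('d::finite, 's::finite) config topology)"
  unfolding config_topology_def by (simp add: compact_space_product_topology compact_space_discrete_topology)

lemma local_fn_indicator: "A \<in> local_sets \<Longrightarrow> local_fn (indicator A)"
  unfolding indicator_def local_sets_def by (auto intro: local_fn_comp)

text \<open>By compactness a finitely additive probability on the algebra of local sets extends to
  a Borel probability.\<close>

lemma measure_of_functional:
  fixes I :: "(('d::finite, 's::finite) config \<Rightarrow> real) \<Rightarrow> real"
  assumes pos: "\<And>f. local_fn f \<Longrightarrow> (\<And>x. 0 \<le> f x) \<Longrightarrow> 0 \<le> I f"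
    and add: "\<And>f g. local_fn f \<Longrightarrow> local_fn g \<Longrightarrow> I (\<lambda>x. f x + g x) = I f + I g"
    and scale: "\<And>c f. local_fn f \<Longrightarrow> I (\<lambda>x. c * f x) = c * I f"
    and one: "I (\<lambda>x. 1) = 1"
  shows "\<exists>M. prob_space M \<and> sets M = sets config_borel \<and> (\<forall>f. local_fn f \<longrightarrow> integral\<^sup>L M f = I f)"
proof -
  interpret algebra "UNIV :: ('d, 's) config set" local_sets by (rule algebra_local_sets)
  let ?f = "\<lambda>A. ennreal (I (indicator A))"
  have zero: "I (indicator {}) = 0" using scale[OF local_fn_const, of 0 0] by (simp add: indicator_def[abs_def])
  have pos': "A \<in> local_sets \<Longrightarrow> 0 \<le> I (indicator A)" for A
    using pos local_fn_indicator by (metis indicator_pos_le)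
  have "\<exists>\<mu> :: ('d, 's) config set \<Rightarrow> ennreal. (\<forall>s \<in> local_sets. \<mu> s = ?f s) \<and>
      measure_space UNIV (sigma_sets UNIV local_sets) \<mu>"
  proof (rule caratheodory_empty_continuous)
    show "positive local_sets ?f" by (simp add: positive_def zero)
    show "additive local_sets ?f"
      unfolding additive_def
    proof (intro ballI impI)
      fix A B :: "('d, 's) config set" assume *: "A \<in> local_sets" "B \<in> local_sets" "A \<inter> B = {}"
      have "indicator (A \<union> B) = (\<lambda>x. indicator A x + indicator B x :: real)"
        using *(3) by (auto simp: indicator_def fun_eq_iff)
      then have "I (indicator (A \<union> B)) = I (indicator A) + I (indicator B)"
        using add[OF local_fn_indicator local_fn_indicator] * by simp
      then show "?f (A \<union> B) = ?f A + ?f B" using pos' * by simp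
    qed
    fix A :: "nat \<Rightarrow> ('d, 's) config set"
    assume A: "range A \<subseteq> local_sets" "decseq A" "(\<Inter>i. A i) = {}"
    \<comment> \<open>Local sets are closed, so a decreasing sequence of nonempty ones would meet in
      a point. The sequence therefore reaches the empty set, and continuity at the empty set is
      trivial.\<close>
    have "\<exists>n. A n = {}"
    proof (rule ccontr)
      assume "\<nexists>n. A n = {}"
      moreover have "closedin config_topology (A n)" for n using A(1) local_sets_closed by blast
      ultimately have "(\<Inter>n. A n) \<noteq> {}"
        using A(2) by (intro compact_space_imp_nest[OF compact_space_config]) auto
      with A show False by simp
    qed
    then obtain n where n: "A n = {}" by blast
    have "\<forall>i\<ge>n. ?f (A i) = 0" using decseqD[OF A(2)] n zero by (metis ennreal_0 subset_empty)
    then show "(\<lambda>i. ?f (A i)) \<longlonglongrightarrow> 0"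
      by (intro tendsto_eventually) (auto simp: eventually_sequentially)
  qed simp
  then obtain \<mu> :: "('d, 's) config set \<Rightarrow> ennreal" where
    \<mu>: "\<And>A. A \<in> local_sets \<Longrightarrow> \<mu> A = ?f A" "measure_space UNIV (sigma_sets UNIV local_sets) \<mu>" by blast
  define M where "M = measure_of UNIV (sigma_sets UNIV local_sets) \<mu>"
  have sM: "sets M = sets config_borel"
    by (simp add: M_def sets_config_borel sigma_sets_sigma_sets_eq)
  have em: "emeasure M A = ?f A" if "A \<in> local_sets" for A
  proof -
    have "emeasure M A = \<mu> A" unfolding M_def
      by (rule emeasure_measure_of_sigma)
        (use \<mu>(2) that in \<open>auto simp: measure_space_def\<close>)
    then show ?thesis by (simp add: \<mu>(1) that)
  qed
  have P: "prob_space M"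
  proof (rule prob_spaceI)
    have "emeasure M UNIV = 1" using em[of UNIV] one by (simp add: indicator_def)
    then show "emeasure M (space M) = 1" using sets_eq_imp_space_eq[OF sM] by simp
  qed
  have "integral\<^sup>L M f = I f" if f: "local_fn f" for f
  proof -
    obtain L where L: "depends_on L f" using f by (auto simp: local_fn_def)
    let ?c = "\<lambda>Y. {x :: ('d, 's) config. code_of L x = Y}"
    have "integral\<^sup>L M f = (\<Sum>Y<CARD('s)^L. f (config_of Y) * measure M (?c Y))"
      by (rule integral_depends_on[OF P sM L])
    also have "\<dots> = (\<Sum>Y<CARD('s)^L. f (config_of Y) * I (indicator (?c Y)))"
      using em pos' by (intro sum.cong) (simp_all add: code_of_local_sets measure_def)
    also have "\<dots> = I (\<lambda>x. \<Sum>Y<CARD('s)^L. f (config_of Y) * indicator (?c Y) x)"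
    proof -
      have "(\<Sum>Y\<in>S. f (config_of Y) * I (indicator (?c Y))) = I (\<lambda>x. \<Sum>Y\<in>S. f (config_of Y) * indicator (?c Y) x)"
        if "finite S" for S using that
      proof (induction S)
        case empty
        show ?case using scale[OF local_fn_const, of 0 0] by simp
      next
        case (insert Y S)
        have 1: "local_fn (\<lambda>x. f (config_of Y) * indicator (?c Y) x)" for Y
          by (rule local_fn_comp[OF local_fn_indicator[OF code_of_local_sets]])
        have "(\<Sum>Y\<in>insert Y S. f (config_of Y) * I (indicator (?c Y))) =
            I (\<lambda>x. f (config_of Y) * indicator (?c Y) x) + I (\<lambda>x. \<Sum>Y\<in>S. f (config_of Y) * indicator (?c Y) x)"
          unfolding sum.insert[OF insert.hyps] insert.IH
          by (subst scale[OF local_fn_indicator[OF code_of_local_sets]]) (rule refl)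
        also have "\<dots> = I (\<lambda>x. f (config_of Y) * indicator (?c Y) x + (\<Sum>Y\<in>S. f (config_of Y) * indicator (?c Y) x))"
          by (rule add[OF 1 local_fn_sum[OF 1], symmetric])
        also have "\<dots> = I (\<lambda>x. \<Sum>Y\<in>insert Y S. f (config_of Y) * indicator (?c Y) x)"
          unfolding sum.insert[OF insert.hyps] ..
        finally show ?case .
      qed
      then show ?thesis by simp
    qed
    also have "(\<lambda>x. \<Sum>Y<CARD('s)^L. f (config_of Y) * indicator (?c Y) x) = f"
      by (rule ext) (rule depends_on_expand[OF L, symmetric])
    finally show ?thesis .
  qed
  with P sM show ?thesis by blast
qed

section \<open>Cesaro means and certificates\<close>

locale uniquely_ergodic_pca =
  fixes ns :: "'d::finite site list"
    and \<phi> :: "'s::finite list \<Rightarrow> 's \<Rightarrow> real"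
    and \<Phi> :: "('d, 's) config \<Rightarrow> ('d, 's) config measure"
    and \<pi> :: "('d, 's) config measure"
  assumes pca: "pca ns \<phi> \<Phi>"
    and inv: "invariant_measure \<Phi> \<pi>"
    and uniq: "\<And>\<mu>. invariant_measure \<Phi> \<mu> \<Longrightarrow> \<mu> = \<pi>"
begin

section \<open>The transition operator on local functions\<close>

definition cyl_prob :: "nat \<Rightarrow> ('d, 's) config \<Rightarrow> nat \<Rightarrow> real" where
  "cyl_prob L x Y = (\<Prod>k<L. \<phi> (map (\<lambda>n. x (site_at k + n)) ns) (letter (digit CARD('s) Y k)))"

definition P :: "(('d, 's) config \<Rightarrow> real) \<Rightarrow> ('d, 's) config \<Rightarrow> real" where
  "P f x = integral\<^sup>L (\<Phi> x) f"

lemma \<phi>_bounds: "length v = length ns \<Longrightarrow> 0 \<le> \<phi> v s" "length v = length ns \<Longrightarrow> \<phi> v s \<le> 1"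
  using pca by (auto simp: pca_def local_rule_def)

lemma prob_\<pi>: "prob_space \<pi>" "sets \<pi> = sets config_borel"
  using inv by (auto simp: invariant_measure_def borel_prob_def)

lemma prob_\<Phi>: "prob_space (\<Phi> x)" "sets (\<Phi> x) = sets config_borel"
proof -
  have "\<Phi> x \<in> space (prob_algebra config_borel)"
    using pca by (intro measurable_space[of \<Phi> config_borel]) (auto simp: pca_def)
  then show "prob_space (\<Phi> x)" "sets (\<Phi> x) = sets config_borel"
    by (auto simp: space_prob_algebra)
qed

lemma measurable_\<Phi>:
  assumes "sets M = sets config_borel"
  shows "\<Phi> \<in> M \<rightarrow>\<^sub>M subprob_algebra config_borel"
  using pca measurable_prob_algebraD[of \<Phi> config_borel] measurable_cong_sets[OF assms refl]
  by (auto simp: pca_def)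

lemma measure_\<Phi>_code_of:
  assumes Y: "Y < CARD('s) ^ L"
  shows "measure (\<Phi> x) {y. code_of L y = Y} = cyl_prob L x Y"
proof -
  let ?u = "\<lambda>s :: 'd site. if idx s < L then Some (letter (digit CARD('s) Y (idx s))) else None :: 's option"
  have dom: "dom ?u = site_at ` {..<L}"
  proof safe
    fix s :: "'d site" and y assume "?u s = Some y"
    then have "idx s < L" by (auto split: if_splits)
    then show "s \<in> site_at ` {..<L}" by (intro image_eqI[of _ _ "idx s"]) auto
  qed auto
  have u: "?u \<in> patterns" by (simp add: patterns_def dom)
  have "{y. code_of L y = Y} = cylinder ?u"
  proof -
    have "y \<in> cylinder ?u \<longleftrightarrow> (\<forall>k<L. y (site_at k) = letter (digit CARD('s) Y k))"
      for y :: "('d, 's) config"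
      unfolding cylinder_def dom by (auto simp: eq_commute)
    then show ?thesis using code_of_eq_iff'[OF Y, where 'd = 'd] by (simp add: set_eq_iff)
  qed
  then have "measure (\<Phi> x) {y. code_of L y = Y} = measure (\<Phi> x) (cylinder ?u)"
    by (rule arg_cong)
  also have "measure (\<Phi> x) (cylinder ?u) =
      (\<Prod>k\<in>dom ?u. \<phi> (map (\<lambda>n. x (k + n)) ns) (the (?u k)))"
    using pca u unfolding pca_def by blast
  also have "\<dots> = cyl_prob L x Y"
    unfolding dom cyl_prob_def by (subst prod.reindex) (auto intro: inj_on_inverseI[of _ idx])
  finally show ?thesis .
qed

lemma P_eq_sum: "depends_on L f \<Longrightarrow> P f x = (\<Sum>Y<CARD('s)^L. f (config_of Y) * cyl_prob L x Y)"
  unfolding P_def integral_depends_on[OF prob_\<Phi>] by (simp add: measure_\<Phi>_code_of)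

lemma local_fn_cyl_prob: "local_fn (\<lambda>x. cyl_prob L x Y)"
proof -
  \<comment> \<open>The numbering of sites does not respect distances, so the larger window comes
    only from the finiteness of the set of neighbours.\<close>
  obtain M where M: "\<And>k n. k < L \<Longrightarrow> n \<in> set ns \<Longrightarrow> site_shift n k < M"
  proof -
    have "finite ((\<lambda>(k, n). site_shift n k) ` ({..<L} \<times> set ns))" by simp
    then obtain M where "\<forall>i\<in>(\<lambda>(k, n). site_shift n k) ` ({..<L} \<times> set ns). i < M"
      unfolding finite_nat_set_iff_bounded by blast
    then have "\<And>k n. k < L \<Longrightarrow> n \<in> set ns \<Longrightarrow> site_shift n k < M" by force
    then show ?thesis by (rule that)
  qed
  have "depends_on M (\<lambda>x. cyl_prob L x Y)"
    unfolding depends_on_def cyl_prob_def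
  proof (intro allI impI prod.cong refl)
    fix x y :: "('d, 's) config" and k
    assume xy: "\<forall>k<M. x (site_at k) = y (site_at k)" and k: "k \<in> {..<L}"
    have "x (site_at k + n) = y (site_at k + n)" if "n \<in> set ns" for n
      using xy M[of k n] k that by (metis site_at_site_shift lessThan_iff)
    then have "map (\<lambda>n. x (site_at k + n)) ns = map (\<lambda>n. y (site_at k + n)) ns" by (rule map_cong[OF refl])
    then show "\<phi> (map (\<lambda>n. x (site_at k + n)) ns) (letter (digit CARD('s) Y k)) =
        \<phi> (map (\<lambda>n. y (site_at k + n)) ns) (letter (digit CARD('s) Y k))" by (rule arg_cong)
  qed
  then show ?thesis by (auto simp: local_fn_def)
qed

text \<open>Finitely many sites have finitely many neighbours. All iterates of \<open>P\<close> thus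
  stay in the class where integrals are finite sums.\<close>

lemma local_fn_P: assumes "local_fn f" shows "local_fn (P f)"
proof -
  obtain L where L: "depends_on L f" using assms by (auto simp: local_fn_def)
  have "P f = (\<lambda>x. \<Sum>Y<CARD('s)^L. f (config_of Y) * cyl_prob L x Y)" using P_eq_sum[OF L] by blast
  then show ?thesis by (simp only:) (intro local_fn_sum local_fn_comp[OF local_fn_cyl_prob])
qed

lemma integrable_\<Phi>: "local_fn f \<Longrightarrow> integrable (\<Phi> x) f" for f :: "('d, 's) config \<Rightarrow> real"
  by (rule integrable_local_fn[OF prob_\<Phi>])

lemma P_add: "local_fn f \<Longrightarrow> local_fn g \<Longrightarrow> P (\<lambda>x. f x + g x) = (\<lambda>x. P f x + P g x)"
  by (auto simp: P_def integrable_\<Phi>)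

lemma P_scale: "P (\<lambda>x. c * f x) = (\<lambda>x. c * P f x)"
  by (simp add: P_def fun_eq_iff)

lemma P_mono: "local_fn f \<Longrightarrow> local_fn g \<Longrightarrow> (\<And>x. f x \<le> g x) \<Longrightarrow> P f x \<le> P g x"
  unfolding P_def by (intro integral_mono integrable_\<Phi>)

lemma P_const: "P (\<lambda>x. c) = (\<lambda>x. c)"
  by (simp add: P_def fun_eq_iff prob_space.prob_space[OF prob_\<Phi>(1)])

lemma P_sum: "(\<And>i. i \<in> A \<Longrightarrow> local_fn (f i)) \<Longrightarrow> P (\<lambda>x. \<Sum>i\<in>A. f i x) = (\<lambda>x. \<Sum>i\<in>A. P (f i) x)"
  unfolding P_def by (intro ext Bochner_Integration.integral_sum integrable_\<Phi>)

lemma local_fn_P_iter: "local_fn f \<Longrightarrow> local_fn ((P ^^ t) f)"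
  by (induction t) (auto intro: local_fn_P)

lemma P_iter_add: "local_fn f \<Longrightarrow> local_fn g \<Longrightarrow> (P ^^ t) (\<lambda>x. f x + g x) = (\<lambda>x. (P ^^ t) f x + (P ^^ t) g x)"
  by (induction t) (auto simp: P_add local_fn_P_iter)

lemma P_iter_scale: "(P ^^ t) (\<lambda>x. c * f x) = (\<lambda>x. c * (P ^^ t) f x)"
  by (induction t) (auto simp: P_scale)

lemma P_iter_const: "(P ^^ t) (\<lambda>x. c) = (\<lambda>x. c)"
  by (induction t) (auto simp: P_const)

lemma P_iter_mono: "local_fn f \<Longrightarrow> local_fn g \<Longrightarrow> (\<And>x. f x \<le> g x) \<Longrightarrow> (P ^^ t) f x \<le> (P ^^ t) g x"
proof (induction t arbitrary: x)
  case (Suc t)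
  show ?case
    using P_mono[OF local_fn_P_iter[OF Suc.prems(1)] local_fn_P_iter[OF Suc.prems(2)] Suc.IH[OF Suc.prems]]
    by simp
qed simp

lemma P_iter_bound:
  assumes f: "local_fn f" and C: "\<And>x. \<bar>f x\<bar> \<le> C"
  shows "\<bar>(P ^^ t) f x\<bar> \<le> C"
proof -
  have "f x \<le> C" "- C \<le> f x" for x using C[of x] by auto
  with P_iter_mono[OF f local_fn_const[of C], of t x] P_iter_mono[OF local_fn_const[of "- C"] f, of t x]
  show ?thesis by (simp add: P_iter_const)
qed

text \<open>Translates between the kernel acting on measures and \<open>P\<close> acting on
  functions: it turns the invariance of \<open>\<pi>\<close> into an identity for integrals, and
  later the invariance of a functional into that of a measure.\<close>

lemma measure_bind_eq:
  assumes M: "prob_space M" "sets M = sets config_borel" and A: "A \<in> local_sets"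
  shows "emeasure (M \<bind> \<Phi>) A = ennreal (\<integral>x. P (indicator A) x \<partial>M)"
proof -
  interpret prob_space M by fact
  have AS: "A \<in> sets config_borel" using A by (rule local_sets_sets)
  have "emeasure (M \<bind> \<Phi>) A = (\<integral>\<^sup>+x. emeasure (\<Phi> x) A \<partial>M)"
    by (rule emeasure_bind[OF not_empty measurable_\<Phi>[OF M(2)] AS])
  also have "\<dots> = (\<integral>\<^sup>+x. ennreal (P (indicator A) x) \<partial>M)"
  proof (rule nn_integral_cong)
    fix x
    interpret N: prob_space "\<Phi> x" by (rule prob_\<Phi>)
    have "P (indicator A) x = measure (\<Phi> x) A"
      using AS prob_\<Phi>(2)[of x] sets_eq_imp_space_eq[OF prob_\<Phi>(2), of x] by (simp add: P_def)
    then show "emeasure (\<Phi> x) A = ennreal (P (indicator A) x)"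
      by (simp add: N.emeasure_eq_measure)
  qed
  also have "\<dots> = ennreal (\<integral>x. P (indicator A) x \<partial>M)"
  proof (rule nn_integral_eq_integral)
    show "integrable M (P (indicator A))"
      using M A by (intro integrable_local_fn local_fn_P local_fn_indicator)
  qed (simp add: P_def)
  finally show ?thesis .
qed

lemma integral_P_\<pi>:
  assumes "local_fn f"
  shows "(\<integral>x. P f x \<partial>\<pi>) = (\<integral>x. f x \<partial>\<pi>)"
proof -
  obtain L where L: "depends_on L f" using assms by (auto simp: local_fn_def)
  let ?c = "\<lambda>Y. {x :: ('d, 's) config. code_of L x = Y}"
  interpret prob_space \<pi> by (rule prob_\<pi>)
  have cyl_prob: "(\<integral>x. cyl_prob L x Y \<partial>\<pi>) = measure \<pi> (?c Y)" if Y: "Y < CARD('s)^L" for Y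
  proof -
    have sp: "space (\<Phi> x) = UNIV" for x using sets_eq_imp_space_eq[OF prob_\<Phi>(2)] by simp
    have PW: "P (indicator (?c Y)) = (\<lambda>x. cyl_prob L x Y)"
      using local_sets_sets[OF code_of_local_sets] prob_\<Phi>(2) measure_\<Phi>_code_of[OF Y]
      by (simp add: P_def sp fun_eq_iff)
    have "emeasure \<pi> (?c Y) = ennreal (\<integral>x. cyl_prob L x Y \<partial>\<pi>)"
      using measure_bind_eq[OF prob_\<pi> code_of_local_sets, of L Y] inv
      by (simp add: PW invariant_measure_def)
    moreover have "0 \<le> (\<integral>x. cyl_prob L x Y \<partial>\<pi>)" by (simp flip: PW add: P_def)
    ultimately show ?thesis by (simp add: measure_def)
  qed
  have "(\<integral>x. P f x \<partial>\<pi>) = (\<integral>x. (\<Sum>Y<CARD('s)^L. f (config_of Y) * cyl_prob L x Y) \<partial>\<pi>)"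
    by (simp add: P_eq_sum[OF L])
  also have "\<dots> = (\<Sum>Y<CARD('s)^L. \<integral>x. f (config_of Y) * cyl_prob L x Y \<partial>\<pi>)"
    by (intro Bochner_Integration.integral_sum integrable_mult_right
        integrable_local_fn[OF prob_\<pi>] local_fn_cyl_prob)
  also have "\<dots> = (\<Sum>Y<CARD('s)^L. f (config_of Y) * measure \<pi> (?c Y))"
    by (simp add: cyl_prob)
  also have "\<dots> = (\<integral>x. f x \<partial>\<pi>)"
    by (rule integral_depends_on[OF prob_\<pi> L, symmetric])
  finally show ?thesis .
qed

section \<open>Cesaro means\<close>

text \<open>For \<open>t = 0\<close> the value is \<open>0 / 0 = 0\<close>, no mean at all; this is
  why the means used later have \<open>Suc t\<close> terms.\<close>

definition avg :: "nat \<Rightarrow> (('d, 's) config \<Rightarrow> real) \<Rightarrow> ('d, 's) config \<Rightarrow> real" where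
  "avg t f x = (\<Sum>s<t. (P ^^ s) f x) / real t"

text \<open>The means of all local functions are determined by countably many of them, those of the
  window indicators. Convergence along a subsequence has to be arranged for these only.\<close>

lemma avg_eq_sum:
  assumes L: "depends_on L f"
  shows "avg t f x = (\<Sum>Y<CARD('s)^L. f (config_of Y) * avg t (indicator {y. code_of L y = Y}) x)"
proof -
  have 1: "local_fn (\<lambda>x. f (config_of Y) * indicator {x. code_of L x = Y} x)" for Y
    by (rule local_fn_comp[OF local_fn_indicator[OF code_of_local_sets]])
  have P_iter_sum: "(P ^^ s) (\<lambda>x. \<Sum>i\<in>A. h i x) = (\<lambda>x. \<Sum>i\<in>A. (P ^^ s) (h i) x)"
    if "\<And>i. i \<in> A \<Longrightarrow> local_fn (h i)" for s A and h :: "nat \<Rightarrow> ('d, 's) config \<Rightarrow> real"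
    using that by (induction s) (auto simp: P_sum local_fn_P_iter)
  have "(P ^^ s) f x = (\<Sum>Y<CARD('s)^L. f (config_of Y) * (P ^^ s) (indicator {y. code_of L y = Y}) x)" for s
  proof -
    have "f = (\<lambda>x. \<Sum>Y<CARD('s)^L. f (config_of Y) * indicator {x. code_of L x = Y} x)"
      using depends_on_expand[OF L] by blast
    then have "(P ^^ s) f x = (P ^^ s) (\<lambda>x. \<Sum>Y<CARD('s)^L. f (config_of Y) * indicator {x. code_of L x = Y} x) x"
      by simp
    then show ?thesis by (simp only: P_iter_sum[OF 1] P_iter_scale)
  qed
  then show ?thesis
    unfolding avg_def by (simp only: sum_divide_distrib sum_distrib_left times_divide_eq_right)
      (rule sum.swap)
qed

text \<open>Otherwise a limit point of the Cesaro means at bad configurations would be an invariant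
  measure different from \<open>\<pi>\<close>.\<close>

lemma avg_eventually_le:
  assumes f: "local_fn f" and c: "integral\<^sup>L \<pi> f < c"
  shows "\<exists>t. \<forall>x. avg (Suc t) f x \<le> c"
proof (rule ccontr)
  assume "\<not> ?thesis"
  \<comment> \<open>The bad configuration may vary with \<open>t\<close>; what is refuted is the
    failure of a bound uniform in \<open>x\<close>.\<close>
  then obtain xx where xx: "\<And>t. c < avg (Suc t) f (xx t)" by (metis not_le)
  \<comment> \<open>The means of the window indicators form a point of a product of unit intervals
    over a countable index set. Sequential compactness of this product replaces a diagonal
    argument.\<close>
  define \<Lambda> where "\<Lambda> t = (\<lambda>(L, Y). avg (Suc t) (indicator {y. code_of L y = Y}) (xx t))" for t
  have \<Lambda>01: "\<Lambda> t LY \<in> {0..1}" for t LY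
  proof -
    obtain L Y where LY: "LY = (L, Y)" by force
    let ?i = "indicator {y :: ('d, 's) config. code_of L y = Y} :: _ \<Rightarrow> real"
    have i: "local_fn ?i" by (rule local_fn_indicator[OF code_of_local_sets])
    have "0 \<le> (P ^^ s) ?i x" "(P ^^ s) ?i x \<le> 1" for s x
      using P_iter_mono[OF local_fn_const[of 0] i, of s x] P_iter_mono[OF i local_fn_const[of 1], of s x]
      by (simp_all add: P_iter_const indicator_def)
    then have "0 \<le> (\<Sum>s<Suc t. (P ^^ s) ?i (xx t))" "(\<Sum>s<Suc t. (P ^^ s) ?i (xx t)) \<le> (\<Sum>s<Suc t. 1)"
      by (intro sum_nonneg sum_mono; simp)+
    then show ?thesis unfolding LY \<Lambda>_def avg_def by (simp add: divide_le_eq)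
  qed
  have "compact (Pi\<^sub>E UNIV (\<lambda>_. {0..1}) :: (nat \<times> nat \<Rightarrow> real) set)"
    using compactin_PiE[of "\<lambda>_. euclidean" UNIV "\<lambda>_ :: nat \<times> nat. {0..1 :: real}"]
    by (simp add: euclidean_product_topology)
  then have "seq_compact (Pi\<^sub>E UNIV (\<lambda>_. {0..1}) :: (nat \<times> nat \<Rightarrow> real) set)"
    by (rule compact_imp_seq_compact)
  moreover have "\<forall>t. \<Lambda> t \<in> Pi\<^sub>E UNIV (\<lambda>_. {0..1})" using \<Lambda>01 by auto
  ultimately obtain l r where r: "strict_mono r" "(\<Lambda> \<circ> r) \<longlonglongrightarrow> l"
    unfolding seq_compact_def by metis
  have lim: "(\<lambda>j. \<Lambda> (r j) (L, Y)) \<longlonglongrightarrow> l (L, Y)" for L Y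
    using continuous_on_tendsto_compose[OF continuous_on_product_coordinates r(2), of "(L, Y)"]
    by simp
  \<comment> \<open>On a local function this is a genuine limit, because its means are finite
    combinations of coordinates of \<open>\<Lambda>\<close>.\<close>
  define I where "I g = Lim sequentially (\<lambda>j. avg (Suc (r j)) g (xx (r j)))" for g
  have I: "(\<lambda>j. avg (Suc (r j)) g (xx (r j))) \<longlonglongrightarrow> I g" if g: "local_fn g" for g
  proof -
    obtain L where L: "depends_on L g" using g by (auto simp: local_fn_def)
    have "(\<lambda>j. \<Sum>Y<CARD('s)^L. g (config_of Y) * \<Lambda> (r j) (L, Y)) \<longlonglongrightarrow> (\<Sum>Y<CARD('s)^L. g (config_of Y) * l (L, Y))"
      by (intro tendsto_intros lim)
    then have "(\<lambda>j. avg (Suc (r j)) g (xx (r j))) \<longlonglongrightarrow> (\<Sum>Y<CARD('s)^L. g (config_of Y) * l (L, Y))"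
      by (subst avg_eq_sum[OF L]) (simp add: \<Lambda>_def)
    then show ?thesis unfolding I_def by (simp add: tendsto_Lim)
  qed
  have "\<exists>M. prob_space M \<and> sets M = sets config_borel \<and> (\<forall>f. local_fn f \<longrightarrow> integral\<^sup>L M f = I f)"
  proof (rule measure_of_functional)
    fix f g :: "('d, 's) config \<Rightarrow> real" and a
    assume f: "local_fn f"
    show "0 \<le> I f" if "\<And>x. 0 \<le> f x"
    proof (rule LIMSEQ_le_const[OF I[OF f]])
      have "0 \<le> (P ^^ s) f x" for s x
        using P_iter_mono[OF local_fn_const[of 0] f, of s x] that by (simp add: P_iter_const)
      then show "\<exists>N. \<forall>n\<ge>N. 0 \<le> avg (Suc (r n)) f (xx (r n))"
        unfolding avg_def by (intro exI allI impI divide_nonneg_nonneg sum_nonneg) auto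
    qed
    show "I (\<lambda>x. f x + g x) = I f + I g" if g: "local_fn g"
    proof (rule LIMSEQ_unique[OF I])
      show "local_fn (\<lambda>x. f x + g x)" using f g by (rule local_fn_comp2)
      show "(\<lambda>j. avg (Suc (r j)) (\<lambda>x. f x + g x) (xx (r j))) \<longlonglongrightarrow> I f + I g"
        using tendsto_add[OF I[OF f] I[OF g]]
        by (simp add: avg_def P_iter_add[OF f g] sum.distrib add_divide_distrib)
    qed
    show "I (\<lambda>x. a * f x) = a * I f"
    proof (rule LIMSEQ_unique[OF I])
      show "local_fn (\<lambda>x. a * f x)" using f by (rule local_fn_comp)
      show "(\<lambda>j. avg (Suc (r j)) (\<lambda>x. a * f x) (xx (r j))) \<longlonglongrightarrow> a * I f"
        using tendsto_mult_left[OF I[OF f], of a]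
        by (simp add: avg_def P_iter_scale distrib_left flip: sum_distrib_left)
    qed
  next
    show "I (\<lambda>x. 1) = 1"
      using I[OF local_fn_const[of 1]]
      by (intro LIMSEQ_unique[OF I[OF local_fn_const]]) (simp add: avg_def P_iter_const)
  qed
  then obtain M where M: "prob_space M" "sets M = sets config_borel"
    and MI: "\<And>f. local_fn f \<Longrightarrow> integral\<^sup>L M f = I f" by blast
  \<comment> \<open>The sums defining the means of \<open>P g\<close> and of \<open>g\<close> differ
    by two boundary terms, so the means differ by at most \<open>2 * C\<close> over the number of
    terms.\<close>
  have IP: "I (P g) = I g" if g: "local_fn g" for g
  proof -
    obtain C where C: "\<And>x. \<bar>g x\<bar> \<le> C" using local_fn_bounded[OF g] by blast
    have "(\<lambda>j. avg (Suc (r j)) (P g) (xx (r j)) - avg (Suc (r j)) g (xx (r j))) \<longlonglongrightarrow> I (P g) - I g"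
      by (intro tendsto_diff I g local_fn_P)
    moreover have "(\<lambda>j. avg (Suc (r j)) (P g) (xx (r j)) - avg (Suc (r j)) g (xx (r j))) \<longlonglongrightarrow> 0"
    proof (rule Lim_null_comparison)
      have "\<bar>avg (Suc t) (P g) x - avg (Suc t) g x\<bar> \<le> 2 * C * inverse (real (Suc t))" for t x
      proof -
        have "avg (Suc t) (P g) x - avg (Suc t) g x =
            (\<Sum>s<Suc t. (P ^^ Suc s) g x - (P ^^ s) g x) / real (Suc t)"
          unfolding avg_def by (simp only: funpow_Suc_right comp_def sum_subtractf diff_divide_distrib)
        also have "\<dots> = ((P ^^ Suc t) g x - g x) / real (Suc t)"
          by (subst sum_lessThan_telescope) simp
        finally show ?thesis
          using P_iter_bound[OF g C, of "Suc t" x] C[of x]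
          by (simp add: field_simps abs_if split: if_splits)
      qed
      then show "\<forall>\<^sub>F j in sequentially. norm (avg (Suc (r j)) (P g) (xx (r j)) - avg (Suc (r j)) g (xx (r j)))
          \<le> 2 * C * inverse (real (Suc (r j)))" by simp
      have "(\<lambda>t. 2 * C * inverse (real (Suc t))) \<longlonglongrightarrow> 2 * C * 0"
        by (intro tendsto_mult_left LIMSEQ_inverse_real_of_nat)
      from LIMSEQ_subseq_LIMSEQ[OF this r(1)]
      show "(\<lambda>j. 2 * C * inverse (real (Suc (r j)))) \<longlonglongrightarrow> 0" by (simp add: comp_def)
    qed
    ultimately show ?thesis using LIMSEQ_unique by fastforce
  qed
  have "M \<bind> \<Phi> = M"
  proof (rule measure_eqI_local_sets[symmetric, OF M])
    show "sets (M \<bind> \<Phi>) = sets config_borel"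
      by (rule sets_bind) (auto simp: prob_\<Phi> prob_space.not_empty[OF M(1)])
    interpret prob_space M by fact
    fix A :: "('d, 's) config set" assume A: "A \<in> local_sets"
    then have "A \<in> sets M" using local_sets_sets M(2) by blast
    then have "integral\<^sup>L M (indicator A) = measure M A" by simp
    then show "emeasure M A = emeasure (M \<bind> \<Phi>) A"
      using MI[OF local_fn_P[OF local_fn_indicator[OF A]]] MI[OF local_fn_indicator[OF A]]
        IP[OF local_fn_indicator[OF A]]
      by (simp add: measure_bind_eq[OF M A] emeasure_eq_measure)
  qed
  then have "M = \<pi>" by (intro uniq) (simp add: invariant_measure_def borel_prob_def M)
  then have "integral\<^sup>L \<pi> f = I f" using MI[OF f] by simp
  moreover have "c \<le> I f"
    by (rule LIMSEQ_le_const[OF I[OF f]]) (use xx less_imp_le in blast)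
  ultimately show False using c by simp
qed

section \<open>Bounds on the mean as one-step inequalities\<close>

text \<open>A corrector \<open>h\<close> replaces \<open>f\<close> by a Cesaro mean, which is at
  most \<open>c\<close> everywhere. A local function is bounded and \<open>P\<close> fixes
  constants, so adding a bound of \<open>h\<close> gives nonnegativity and cancels from both
  sides.\<close>

lemma superharmonic_certificate:
  assumes f: "local_fn f" and c: "integral\<^sup>L \<pi> f < c"
  shows "\<exists>g. local_fn g \<and> (\<forall>x. 0 \<le> g x) \<and> (\<forall>x. f x + g x \<le> c + P g x)"
proof -
  obtain t where t: "\<And>x. avg (Suc t) f x \<le> c" using avg_eventually_le[OF f c] by blast
  \<comment> \<open>This \<open>h\<close> solves the Poisson equation \<open>P h - h = f - avg (Suc t) f\<close>.\<close>
  define h where "h x = (\<Sum>s<Suc t. \<Sum>r<s. (P ^^ r) f x) * (- 1 / real (Suc t))" for x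
  have lh1: "local_fn (\<lambda>x. \<Sum>r<s. (P ^^ r) f x)" for s
    by (intro local_fn_sum local_fn_P_iter f)
  have lh2: "local_fn (\<lambda>x. \<Sum>s<Suc t. \<Sum>r<s. (P ^^ r) f x)"
    by (intro local_fn_sum local_fn_P_iter f)
  have lh: "local_fn h" unfolding h_def by (rule local_fn_comp[OF lh2])
  obtain C where C: "\<And>x. \<bar>h x\<bar> \<le> C" using local_fn_bounded[OF lh] by blast
  have "P h x = (\<Sum>s<Suc t. \<Sum>r<s. (P ^^ Suc r) f x) * (- 1 / real (Suc t))" for x
    unfolding h_def mult.commute[of _ "- 1 / real (Suc t)"] P_scale P_sum[OF lh1]
    by (simp add: P_sum[OF local_fn_P_iter[OF f]])
  then have "P h x - h x = (\<Sum>s<Suc t. \<Sum>r<s. (P ^^ Suc r) f x - (P ^^ r) f x) * (- 1 / real (Suc t))" for x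
    unfolding h_def by (simp only: sum_subtractf left_diff_distrib)
  also have "(\<Sum>s<Suc t. \<Sum>r<s. (P ^^ Suc r) f x - (P ^^ r) f x) =
      (\<Sum>s<Suc t. (P ^^ s) f x) - real (Suc t) * f x" for x
    by (subst sum_lessThan_telescope) (simp add: sum_subtractf algebra_simps)
  also have "(\<dots> x) * (- 1 / real (Suc t)) = f x - avg (Suc t) f x" for x
    unfolding avg_def by (simp add: field_simps)
  finally have Ph: "P h x - h x = f x - avg (Suc t) f x" for x .
  show ?thesis
  proof (intro exI[of _ "\<lambda>x. h x + C"] conjI allI)
    show "local_fn (\<lambda>x. h x + C)" by (rule local_fn_comp[OF lh])
    fix x
    show "0 \<le> h x + C" using C[of x] by simp
    have "P (\<lambda>x. h x + C) x = P h x + C"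
      using P_add[OF lh local_fn_const[of C]] by (simp add: P_const)
    then show "f x + (h x + C) \<le> c + P (\<lambda>x. h x + C) x" using Ph[of x] t[of x] by simp
  qed
qed

lemma integral_le_of_certificate:
  assumes f: "local_fn f" and g: "local_fn g" and le: "\<And>x. f x + g x \<le> c + P g x"
  shows "integral\<^sup>L \<pi> f \<le> c"
proof -
  interpret prob_space \<pi> by (rule prob_\<pi>)
  have int: "local_fn h \<Longrightarrow> integrable \<pi> h" for h :: "('d, 's) config \<Rightarrow> real"
    by (rule integrable_local_fn[OF prob_\<pi>])
  have "(\<integral>x. f x + g x \<partial>\<pi>) \<le> (\<integral>x. c + P g x \<partial>\<pi>)"
    by (intro integral_mono le Bochner_Integration.integrable_add int f g local_fn_P local_fn_const)
  then show ?thesis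
    by (simp add: int f g local_fn_P integral_P_\<pi> prob_space)
qed

end

section \<open>The search for certificates\<close>

text \<open>The index set is part of the fixed data and not an argument, so the summands may be
  unrelated recursive functions. Finite tables are built in this way.\<close>

lemma rec_fn_finite_sum:
  "(\<And>a. a \<in> A \<Longrightarrow> rec_fn n (F a)) \<Longrightarrow> rec_fn n (\<lambda>xs. \<Sum>a\<in>A. F a xs)"
  by (induction A rule: infinite_finite_induct) (auto intro: rec_fn_const rec_fn_add)

lemma rec_pred_list_all: "(\<And>v. v \<in> set vs \<Longrightarrow> rec_pred n (Q v)) \<Longrightarrow> rec_pred n (\<lambda>xs. \<forall>v\<in>set vs. Q v xs)"
proof (induction vs)
  case (Cons v vs)
  then have "rec_pred n (\<lambda>xs. Q v xs \<and> (\<forall>v\<in>set vs. Q v xs))" by (intro rec_pred_conj) auto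
  then show ?case by simp
qed (simp add: rec_pred_def rec_fn_const)

section \<open>Integer lower bounds for the local rule\<close>

text \<open>In the alternating code of integers the absolute value of the number coded by
  \<open>a\<close> is \<open>Suc a div 2\<close>. A zero denominator is harmless, since
  \<open>Fract i 0\<close> and real division by 0 both give 0.\<close>

lemma abs_nat_to_rat_surj:
  "\<bar>real_of_rat (nat_to_rat_surj z)\<bar> = real (Suc (pfst z) div 2) / real (Suc (psnd z) div 2)"
proof -
  have int: "\<bar>int_decode a\<bar> = int (Suc a div 2)" for a
    by (cases "even a") (auto simp: int_decode_def sum_decode_def elim!: evenE oddE)
  have "\<bar>real_of_rat (Fract i j)\<bar> = \<bar>real_of_int i\<bar> / \<bar>real_of_int j\<bar>" for i j
    by (cases "j = 0") (auto simp: of_rat_rat rat_number_collapse abs_divide)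
  then have "\<bar>real_of_rat (nat_to_rat_surj z)\<bar> =
      real_of_int \<bar>int_decode (pfst z)\<bar> / real_of_int \<bar>int_decode (psnd z)\<bar>"
    by (simp add: nat_to_rat_surj_def split_beta)
  then show ?thesis unfolding int by simp
qed

text \<open>The sign of the approximating rationals can be dropped because \<open>p\<close> is nonnegative.\<close>

lemma computable_real_lower_approx:
  assumes p: "computable_real p" "0 \<le> p"
  shows "\<exists>A. rec_fn 1 (\<lambda>xs. A (xs ! 0)) \<and> (\<forall>q. real (A q) \<le> real q * p \<and> real q * p - 3 \<le> real (A q))"
proof -
  obtain f g where g: "recursive_fn 1 g" and f: "\<And>n. f n = nat_to_rat_surj (g [n])"
    and fp: "\<And>n. n > 0 \<Longrightarrow> \<bar>of_rat (f n) - p\<bar> < 1 / real n"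
    using p by (auto simp: computable_real_def computable_rat_seq_def)
  define N where "N q = Suc (pfst (g [q])) div 2" for q
  define D where "D q = Suc (psnd (g [q])) div 2" for q
  have g1: "rec_fn 1 (\<lambda>xs. g [xs ! 0])"
    using g unfolding rec_fn_def by (intro exI[of _ g]) (auto simp: length_Suc_conv)
  \<comment> \<open>Multiplying by \<open>q\<close> turns the error \<open>1 / q\<close> into an
    error below 1, and rounding down loses less than 1. Subtracting 1 forces a lower bound; the
    total loss stays below 3, and truncation at 0 is safe as \<open>p\<close> is
    nonnegative.\<close>
  define A where "A q = N q * q div D q - 1" for q
  have "rec_fn 1 (\<lambda>xs. A (xs ! 0))"
    unfolding A_def N_def D_def by (intro rec_fn_intros g1) auto
  moreover have "real (A q) \<le> real q * p \<and> real q * p - 3 \<le> real (A q)" for q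
  proof (cases "q = 0")
    case True
    then show ?thesis by (simp add: A_def)
  next
    case False
    have fq: "\<bar>real_of_rat (f q)\<bar> = real (N q) / real (D q)"
      by (simp only: f abs_nat_to_rat_surj N_def D_def)
    have "\<bar>\<bar>of_rat (f q)\<bar> - p\<bar> \<le> \<bar>of_rat (f q) - p\<bar>" using p(2) by linarith
    also have "\<dots> < 1 / real q" using fp False by simp
    finally have *: "\<bar>real (N q) / real (D q) - p\<bar> < 1 / real q"
      by (simp only: fq)
    have "\<bar>real q * (real (N q) / real (D q)) - real q * p\<bar> =
        real q * \<bar>real (N q) / real (D q) - p\<bar>"
      by (subst right_diff_distrib[symmetric]) (simp add: abs_mult)
    also have "\<dots> < 1" using * False by (simp add: field_simps)
    finally have "\<bar>real (N q * q) / real (D q) - real q * p\<bar> < 1" by (simp add: mult.commute)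
    moreover have "real (N q * q div D q) = of_int \<lfloor>real (N q * q) / real (D q)\<rfloor>"
      unfolding floor_divide_of_nat_eq by simp
    moreover have "real (N q * q div D q - 1) = max 0 (real (N q * q div D q) - 1)"
      by (cases "N q * q div D q") auto
    moreover have "0 \<le> real q * p" using p(2) by simp
    ultimately show ?thesis unfolding A_def by linarith
  qed
  ultimately show ?thesis by blast
qed

text \<open>Words of equal length together with a symbol are written injectively in base
  \<open>CARD('s)\<close>, so the local rule becomes a table indexed by numbers.\<close>

fun key :: "'s::finite list \<Rightarrow> 's \<Rightarrow> nat" where
  "key [] s = letter_idx s"
| "key (a # v) s = letter_idx a + CARD('s) * key v s"

lemma letter_idx_inject: "letter_idx s = letter_idx t \<longleftrightarrow> s = t"
  by (metis letter_letter_idx)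

lemma key_inject: "length v = length w \<Longrightarrow> key v s = key w t \<longleftrightarrow> v = w \<and> s = t"
proof (induction v w rule: list_induct2)
  case (Cons a v b w)
  have "letter_idx a + CARD('a) * m = letter_idx b + CARD('a) * n \<longleftrightarrow> a = b \<and> m = n" for m n
  proof
    assume eq: "letter_idx a + CARD('a) * m = letter_idx b + CARD('a) * n"
    from arg_cong[OF eq, of "\<lambda>k. k mod CARD('a)"] have "letter_idx a = letter_idx b" by simp
    with eq show "a = b \<and> m = n" by (simp add: letter_idx_inject)
  qed simp
  with Cons show ?case by auto
qed (simp add: letter_idx_inject)

lemma letter_idx_config_of:
  fixes v :: "'d::finite site"
  shows "letter_idx (config_of X (site_at k + v) :: 's::finite) = digit CARD('s) X (site_shift v k)"
proof -
  have "idx (site_at k + v) = site_shift v k" by (metis site_at_site_shift idx_site_at)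
  then show ?thesis by (simp add: config_of_def)
qed

lemma rec_fn_key:
  fixes ns :: "'d::finite site list"
  assumes "rec_fn n X" "rec_fn n Y" "rec_fn n k"
  shows "rec_fn n (\<lambda>xs. key (map (\<lambda>v. config_of (X xs) (site_at (k xs) + v)) ns)
    (letter (digit CARD('s) (Y xs) (k xs)) :: 's::finite))"
proof (induction ns)
  case Nil show ?case by (simp add: rec_fn_digit rec_fn_const assms)
next
  case (Cons v ns) then show ?case
    by (simp add: letter_idx_config_of) (intro rec_fn_intros rec_fn_digit rec_fn_site_shift assms)
qed

text \<open>Each of the finitely many entries of the rule comes with its own algorithm. Choosing
  them all and selecting by key gives a single recursive function with one error bound for every
  entry.\<close>

lemma computable_rule_table:
  fixes ns :: "'d::finite site list" and \<phi> :: "'s::finite list \<Rightarrow> 's \<Rightarrow> real"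
  assumes comp: "computable_rule ns \<phi>"
    and pos: "\<And>v s. length v = length ns \<Longrightarrow> 0 \<le> \<phi> v s"
  shows "\<exists>T. rec_fn 2 (\<lambda>xs. T (xs ! 0) (xs ! 1)) \<and>
    (\<forall>q v s. length v = length ns \<longrightarrow>
      real (T q (key v s)) \<le> real q * \<phi> v s \<and> real q * \<phi> v s - 3 \<le> real (T q (key v s)))"
proof -
  have "\<forall>v s. \<exists>A. length v = length ns \<longrightarrow> rec_fn 1 (\<lambda>xs. A (xs ! 0)) \<and>
      (\<forall>q. real (A q) \<le> real q * \<phi> v s \<and> real q * \<phi> v s - 3 \<le> real (A q))"
    using comp pos computable_real_lower_approx unfolding computable_rule_def by blast
  then obtain A where A: "\<And>v s. length v = length ns \<Longrightarrow> rec_fn 1 (\<lambda>xs. A v s (xs ! 0))"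
    "\<And>v s q. length v = length ns \<Longrightarrow> real (A v s q) \<le> real q * \<phi> v s \<and> real q * \<phi> v s - 3 \<le> real (A v s q)"
    by metis
  define S where "S = {v :: 's list. length v = length ns} \<times> (UNIV :: 's set)"
  have finS: "finite S" unfolding S_def using finite_lists_length_eq[of "UNIV :: 's set"] by simp
  define T where "T q t = (\<Sum>(v, s)\<in>S. of_bool (t = key v s) * A v s q)" for q t
  have T: "T q (key v s) = A v s q" if "length v = length ns" for q v s
  proof -
    have "T q (key v s) = (\<Sum>i\<in>S. if i = (v, s) then A v s q else 0)"
      unfolding T_def by (intro sum.cong) (auto simp: S_def key_inject that)
    also have "\<dots> = A v s q" using finS that by (subst sum.delta) (auto simp: S_def)
    finally show ?thesis .
  qed
  have "rec_fn 2 (\<lambda>xs. T (xs ! 0) (xs ! 1))"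
    unfolding T_def split_beta
    by (intro rec_fn_finite_sum rec_fn_intros rec_fn_comp1[OF A(1)]) (auto simp: S_def)
  with A(2) show ?thesis by (intro exI[of _ T]) (simp add: T)
qed

section \<open>Patterns as decidable events\<close>

text \<open>Pattern codes name letters by \<open>to_nat\<close>, digits by
  \<open>letter_idx\<close>; this finite table translates the second into the first.\<close>

definition symbol_code :: "'s::finite itself \<Rightarrow> nat \<Rightarrow> nat" where
  "symbol_code _ j = (\<Sum>a<CARD('s). of_bool (j = a) * to_nat (letter a :: 's))"

lemma symbol_code_letter_idx: "symbol_code TYPE('s::finite) (letter_idx (s :: 's)) = to_nat s"
proof -
  have "symbol_code TYPE('s) (letter_idx s) = (\<Sum>a<CARD('s). if a = letter_idx s then to_nat s else 0)"
    unfolding symbol_code_def by (intro sum.cong) auto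
  then show ?thesis by simp
qed

lemma rec_fn_symbol_code: "rec_fn n f \<Longrightarrow> rec_fn n (\<lambda>xs. symbol_code TYPE('s::finite) (f xs))"
  unfolding symbol_code_def by (intro rec_fn_finite_sum rec_fn_intros) auto

text \<open>Defined for every code \<open>c\<close>, so that the search below terminates on codes of no pattern too.\<close>

definition event :: "nat \<Rightarrow> ('d::finite, 's::finite) config \<Rightarrow> bool" where
  "event c x \<longleftrightarrow> (\<forall>e<c. (c div 2 ^ e) mod 2 = 1 \<longrightarrow>
    to_nat (x (site_at (idx_of_code (CARD('d) - 1) (pfst e)))) = psnd e)"

lemma event_config_of: "event c (config_of X :: ('d::finite, 's::finite) config) \<longleftrightarrow>
    (\<forall>e<c. (c div 2 ^ e) mod 2 = 1 \<longrightarrow>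
      symbol_code TYPE('s) (digit CARD('s) X (idx_of_code (CARD('d) - 1) (pfst e))) = psnd e)"
proof -
  have "to_nat (config_of X (site_at k :: 'd site) :: 's) = symbol_code TYPE('s) (digit CARD('s) X k)" for k
    using symbol_code_letter_idx[of "letter (digit CARD('s) X k) :: 's"] by (simp add: config_of_site_at)
  then show ?thesis by (simp add: event_def)
qed

lemma rec_pred_event:
  assumes "rec_fn n c" "rec_fn n X"
  shows "rec_pred n (\<lambda>xs. event (c xs) (config_of (X xs) :: ('d::finite, 's::finite) config))"
  unfolding event_config_of
  by (intro rec_fn_intros rec_fn_symbol_code rec_fn_digit rec_fn_idx_of_code assms rec_fn_tl[OF assms(1)] rec_fn_tl[OF assms(2)]) auto

lemma depends_on_event:
  assumes "\<And>e. e < c \<Longrightarrow> idx_of_code (CARD('d) - 1) (pfst e) < M"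
  shows "depends_on M (event c :: ('d::finite, 's::finite) config \<Rightarrow> bool)"
  unfolding depends_on_def event_def using assms by metis

text \<open>A pattern code is the binary code of a finite set of pairs of a site and a letter. An
  element \<open>e\<close> contributes \<open>2 ^ e\<close> to the code and
  \<open>e < 2 ^ e\<close>, so the bound \<open>e < c\<close> in \<open>event\<close> misses no
  element.\<close>

lemma cylinder_eq_event:
  fixes u :: "('d::finite, 's::finite) pattern"
  assumes "u \<in> patterns"
  shows "cylinder u = {x. event (pattern_code u) x}"
proof -
  let ?S = "(\<lambda>k. prod_encode (site_code k, to_nat (the (u k)))) ` dom u"
  let ?c = "pattern_code u"
  have "finite ?S" using assms by (simp add: patterns_def)
  then have S: "set_decode ?c = ?S" by (simp add: pattern_code_def)
  have mem: "e < ?c \<and> (?c div 2 ^ e) mod 2 = 1 \<longleftrightarrow> e \<in> ?S" for e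
  proof -
    have "e < ?c" if "odd (?c div 2 ^ e)"
    proof -
      have "2 ^ e \<le> ?c" using that by (metis div_less even_zero not_le)
      then show ?thesis using less_exp[of e] by linarith
    qed
    then show ?thesis unfolding S[symmetric] set_decode_def by (auto simp: odd_iff_mod_2_eq_one)
  qed
  have "event ?c x \<longleftrightarrow> x \<in> cylinder u" for x :: "('d, 's) config"
  proof -
    have "event ?c x \<longleftrightarrow> (\<forall>e\<in>?S. to_nat (x (site_at (idx_of_code (CARD('d) - 1) (pfst e)))) = psnd e)"
      unfolding event_def using mem by blast
    also have "\<dots> \<longleftrightarrow> (\<forall>k\<in>dom u. to_nat (x k) = to_nat (the (u k)))"
      by (simp add: idx_of_code_site_code[unfolded One_nat_def])
    also have "\<dots> \<longleftrightarrow> x \<in> cylinder u"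
      unfolding cylinder_def mem_Collect_eq by (intro ball_cong refl) auto
    finally show ?thesis .
  qed
  then show ?thesis by blast
qed

context uniquely_ergodic_pca
begin

section \<open>Certificates in integer arithmetic\<close>

text \<open>Each of the \<open>L\<close> factors is scaled by \<open>q\<close>, so for a lower table
  this is an integer lower bound for \<open>q ^ L\<close> times the true probability.\<close>

definition approx_cyl_prob :: "(nat \<Rightarrow> nat \<Rightarrow> nat) \<Rightarrow> nat \<Rightarrow> nat \<Rightarrow> ('d, 's) config \<Rightarrow> nat \<Rightarrow> nat" where
  "approx_cyl_prob T q L x Y =
    (\<Prod>k<L. T q (key (map (\<lambda>n. x (site_at k + n)) ns) (letter (digit CARD('s) Y k))))"

text \<open>The inequality \<open>h + g / q \<le> a / q + P (g / q)\<close> multiplied by \<open>q ^ Suc L\<close>, with the lower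
  approximations \<open>T / q\<close> of the local rule in place of the true transition probabilities.\<close>

definition certificate ::
  "(nat \<Rightarrow> nat \<Rightarrow> nat) \<Rightarrow> (nat \<Rightarrow> nat) \<Rightarrow> nat \<Rightarrow> nat \<Rightarrow> nat \<Rightarrow> nat \<Rightarrow> (nat \<Rightarrow> nat) \<Rightarrow> bool" where
  "certificate T h L M q a g \<longleftrightarrow>
    (\<forall>X<CARD('s)^M. h X * q ^ Suc L + g (X mod CARD('s)^L) * q ^ L \<le>
      a * q ^ L + (\<Sum>Y<CARD('s)^L. approx_cyl_prob T q L (config_of X) Y * g Y))"

text \<open>The window \<open>M\<close> holds the sites that one step of the automaton reads in
  order to determine the window \<open>L\<close>. Checking the codes below
  \<open>CARD('s) ^ M\<close> then settles the inequality for all configurations.\<close>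

definition covers :: "nat \<Rightarrow> nat \<Rightarrow> bool" where
  "covers L M \<longleftrightarrow> L \<le> M \<and> (\<forall>k<L. \<forall>n\<in>set ns. site_shift n k < M)"

definition lower_table :: "(nat \<Rightarrow> nat \<Rightarrow> nat) \<Rightarrow> bool" where
  "lower_table T \<longleftrightarrow> (\<forall>q v s. length v = length ns \<longrightarrow>
      real (T q (key v s)) \<le> real q * \<phi> v s \<and> real q * \<phi> v s - 3 \<le> real (T q (key v s)))"

lemma approx_cyl_prob_le: assumes "lower_table T" shows "real (approx_cyl_prob T q L x Y) \<le> real q ^ L * cyl_prob L x Y"
proof -
  have "real (approx_cyl_prob T q L x Y) \<le>
      (\<Prod>k<L. real q * \<phi> (map (\<lambda>n. x (site_at k + n)) ns) (letter (digit CARD('s) Y k)))"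
    unfolding approx_cyl_prob_def of_nat_prod
    by (intro prod_mono) (use assms in \<open>auto simp: lower_table_def\<close>)
  then show ?thesis by (simp add: cyl_prob_def prod.distrib)
qed

text \<open>Every factor is off by at most \<open>3 / q\<close>, and the number \<open>L\<close> of
  factors is fixed.\<close>

lemma approx_cyl_prob_tendsto:
  assumes "lower_table T"
  shows "(\<lambda>q. real (approx_cyl_prob T q L x Y) / real q ^ L) \<longlonglongrightarrow> cyl_prob L x Y"
proof -
  have "(\<lambda>q. real (T q (key v s)) / real q) \<longlonglongrightarrow> \<phi> v s" if "length v = length ns" for v s
  proof (rule tendsto_sandwich)
    have T: "real (T q (key v s)) \<le> real q * \<phi> v s \<and> real q * \<phi> v s - 3 \<le> real (T q (key v s))" for q
      using assms that by (auto simp: lower_table_def)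
    show "\<forall>\<^sub>F q in sequentially. real (T q (key v s)) / real q \<le> \<phi> v s"
      using eventually_gt_at_top[of 0] by eventually_elim (use T in \<open>simp add: field_simps\<close>)
    show "\<forall>\<^sub>F q in sequentially. \<phi> v s - 3 * inverse (real q) \<le> real (T q (key v s)) / real q"
      using eventually_gt_at_top[of 0]
    proof eventually_elim
      case (elim q)
      have "(real q * \<phi> v s - 3) / real q \<le> real (T q (key v s)) / real q"
        using T by (intro divide_right_mono) auto
      then show ?case using elim by (simp add: diff_divide_distrib inverse_eq_divide)
    qed
    have "(\<lambda>q. \<phi> v s - 3 * inverse (real q)) \<longlonglongrightarrow> \<phi> v s - 3 * 0"
      by (intro tendsto_intros lim_inverse_n)
    then show "(\<lambda>q. \<phi> v s - 3 * inverse (real q)) \<longlonglongrightarrow> \<phi> v s" by simp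
  qed simp
  then have "(\<lambda>q. \<Prod>k<L. real (T q (key (map (\<lambda>n. x (site_at k + n)) ns) (letter (digit CARD('s) Y k)))) / real q)
      \<longlonglongrightarrow> (\<Prod>k<L. \<phi> (map (\<lambda>n. x (site_at k + n)) ns) (letter (digit CARD('s) Y k)))"
    by (intro tendsto_prod) simp
  then show ?thesis by (simp add: cyl_prob_def approx_cyl_prob_def prod_dividef)
qed

lemma certificate_sound:
  assumes T: "lower_table T" and q: "0 < q" and LM: "covers L M"
    and h: "depends_on M h" and cert: "certificate T (\<lambda>X. h (config_of X)) L M q a g"
  shows "integral\<^sup>L \<pi> (\<lambda>x. real (h x)) \<le> real a / real q"
proof (rule integral_le_of_certificate)
  let ?g = "\<lambda>x. real (g (code_of L x)) / real q"
  have g: "depends_on L ?g" by (rule depends_on_code_of_fn)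
  then show "local_fn ?g" unfolding local_fn_def by blast
  have "depends_on M (\<lambda>x. real (h x))" using h by (auto simp: depends_on_def)
  then show "local_fn (\<lambda>x. real (h x))" unfolding local_fn_def by blast
  fix x :: "('d, 's) config"
  let ?X = "code_of M x"
  have eq: "(config_of ?X :: ('d, 's) config) (site_at k) = x (site_at k)" if "k < M" for k using that by (rule config_of_code_of)
  have X: "?X < CARD('s)^M" by (rule code_of_less)
  have "?X mod CARD('s)^L = code_of L (config_of ?X :: ('d, 's) config)" by (simp add: code_of_config_of)
  also have "\<dots> = code_of L x"
    unfolding code_of_eq_iff using LM by (intro allI impI eq) (auto simp: covers_def)
  finally have XL: "?X mod CARD('s)^L = code_of L x" .
  have hX: "h (config_of ?X) = h x" by (rule depends_on_config_of[OF h])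
  \<comment> \<open>By \<open>covers\<close> only sites inside the window \<open>M\<close> are read,
    and there the decoded configuration agrees with \<open>x\<close>.\<close>
  have aX: "approx_cyl_prob T q L (config_of ?X) Y = approx_cyl_prob T q L x Y" for Y
    unfolding approx_cyl_prob_def
  proof (rule prod.cong[OF refl])
    fix k assume "k \<in> {..<L}"
    then have "config_of ?X (site_at k + n) = x (site_at k + n)" if "n \<in> set ns" for n
      using eq[of "site_shift n k"] LM that by (simp add: covers_def site_at_site_shift)
    then have "map (\<lambda>n. config_of ?X (site_at k + n)) ns = map (\<lambda>n. x (site_at k + n)) ns" by simp
    then show "T q (key (map (\<lambda>n. config_of ?X (site_at k + n)) ns) (letter (digit CARD('s) Y k) :: 's)) =
      T q (key (map (\<lambda>n. x (site_at k + n)) ns) (letter (digit CARD('s) Y k)))" by (simp only:)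
  qed
  have "h x * q ^ Suc L + g (code_of L x) * q ^ L \<le>
      a * q ^ L + (\<Sum>Y<CARD('s)^L. approx_cyl_prob T q L x Y * g Y)"
    using cert X unfolding certificate_def by (metis (no_types, lifting) XL hX aX sum.cong)
  then have "real (h x * q ^ Suc L + g (code_of L x) * q ^ L) \<le>
      real (a * q ^ L + (\<Sum>Y<CARD('s)^L. approx_cyl_prob T q L x Y * g Y))"
    by (simp only: of_nat_le_iff)
  also have "\<dots> = real a * real q ^ L + (\<Sum>Y<CARD('s)^L. real (approx_cyl_prob T q L x Y) * real (g Y))"
    by simp
  \<comment> \<open>Nonnegativity enters here: the weights \<open>g Y\<close> are natural numbers,
    so passing from the lower approximations to the true probabilities only increases the right-hand
    side.\<close>
  also have "\<dots> \<le> real a * real q ^ L + (\<Sum>Y<CARD('s)^L. (real q ^ L * cyl_prob L x Y) * real (g Y))"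
    by (intro add_left_mono sum_mono mult_right_mono approx_cyl_prob_le T) simp
  also have "\<dots> = real q ^ L * (real a + (\<Sum>Y<CARD('s)^L. real (g Y) * cyl_prob L x Y))"
    by (simp add: distrib_left sum_distrib_left mult_ac)
  finally have "real q ^ L * (real (h x) * real q + real (g (code_of L x))) \<le>
      real q ^ L * (real a + (\<Sum>Y<CARD('s)^L. real (g Y) * cyl_prob L x Y))"
    by (simp add: distrib_left mult_ac)
  then have "real (h x) * real q + real (g (code_of L x)) \<le> real a + (\<Sum>Y<CARD('s)^L. real (g Y) * cyl_prob L x Y)"
    using q by simp
  then have "(real (h x) * real q + real (g (code_of L x))) / real q \<le>
      (real a + (\<Sum>Y<CARD('s)^L. real (g Y) * cyl_prob L x Y)) / real q"
    by (rule divide_right_mono) simp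
  then have "real (h x) + ?g x \<le> real a / real q + (\<Sum>Y<CARD('s)^L. real (g Y) * cyl_prob L x Y) / real q"
    using q by (simp add: add_divide_distrib)
  also have "(\<Sum>Y<CARD('s)^L. real (g Y) * cyl_prob L x Y) / real q = P ?g x"
    unfolding P_eq_sum[OF g] by (simp add: code_of_config_of sum_divide_distrib)
  finally show "real (h x) + ?g x \<le> real a / real q + P ?g x" .
qed

text \<open>The slack between \<open>c'\<close> and \<open>c\<close> absorbs both the rounding of
  \<open>G\<close> and the defect of the table. Allowing every large \<open>L\<close>, every
  \<open>M\<close> and then every large \<open>q\<close> lets the certificates of an event and of
  its complement share these parameters.\<close>

lemma certificate_complete:
  assumes T: "lower_table T" and h: "local_fn h" and c: "integral\<^sup>L \<pi> (\<lambda>x. real (h x)) < c"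
  shows "\<exists>L0. \<forall>L\<ge>L0. \<forall>M. \<forall>\<^sub>F q in sequentially.
    \<exists>g. certificate T (\<lambda>X. h (config_of X)) L M q (nat \<lceil>c * real q\<rceil>) g"
proof -
  from c obtain c' where c': "integral\<^sup>L \<pi> (\<lambda>x. real (h x)) < c'" "c' < c"
    using dense by blast
  obtain G where G: "local_fn G" "\<And>x. 0 \<le> G x" "\<And>x. real (h x) + G x \<le> c' + P G x"
    using superharmonic_certificate[OF local_fn_comp[OF h] c'(1)] by blast
  obtain L0 where L0: "depends_on L0 G" using G(1) by (auto simp: local_fn_def)
  have "\<forall>\<^sub>F q in sequentially. \<exists>g. certificate T (\<lambda>X. h (config_of X)) L M q (nat \<lceil>c * real q\<rceil>) g"
    if "L0 \<le> L" for L M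
  proof -
    have L: "depends_on L G" using L0 that by (rule depends_on_mono)
    \<comment> \<open>Rounding down keeps the left-hand side below \<open>h + G\<close>; the loss
      this causes on the right vanishes as \<open>q\<close> grows.\<close>
    define g where "g q Y = nat \<lfloor>real q * G (config_of Y)\<rfloor>" for q Y
    have g_le: "real (g q Y) \<le> real q * G (config_of Y)" for q Y
      using G(2)[of "config_of Y"] by (simp add: g_def)
    have g_ge: "real q * G (config_of Y) - 1 \<le> real (g q Y)" for q Y
      unfolding g_def by linarith
    have g_lim: "(\<lambda>q. real (g q Y) / real q) \<longlonglongrightarrow> G (config_of Y)" for Y
    proof (rule tendsto_sandwich)
      show "\<forall>\<^sub>F q in sequentially. real (g q Y) / real q \<le> G (config_of Y)"
        using eventually_gt_at_top[of 0] by eventually_elim (use g_le in \<open>simp add: field_simps\<close>)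
      show "\<forall>\<^sub>F q in sequentially. G (config_of Y) - inverse (real q) \<le> real (g q Y) / real q"
        using eventually_gt_at_top[of 0]
      proof eventually_elim
        case (elim q)
        have "(real q * G (config_of Y) - 1) / real q \<le> real (g q Y) / real q"
          by (rule divide_right_mono[OF g_ge]) simp
        then show ?case using elim by (simp add: diff_divide_distrib inverse_eq_divide)
      qed
      have "(\<lambda>q. G (config_of Y) - inverse (real q)) \<longlonglongrightarrow> G (config_of Y) - 0"
        by (intro tendsto_intros lim_inverse_n)
      then show "(\<lambda>q. G (config_of Y) - inverse (real q)) \<longlonglongrightarrow> G (config_of Y)" by simp
    qed simp
    have ev: "\<forall>\<^sub>F q in sequentially. h x * q ^ Suc L + g q (code_of L x) * q ^ L \<le>
        nat \<lceil>c * real q\<rceil> * q ^ L + (\<Sum>Y<CARD('s)^L. approx_cyl_prob T q L x Y * g q Y)" for x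
    proof -
      have "(\<lambda>q. c + (\<Sum>Y<CARD('s)^L. (real (approx_cyl_prob T q L x Y) / real q ^ L) * (real (g q Y) / real q)))
          \<longlonglongrightarrow> c + (\<Sum>Y<CARD('s)^L. cyl_prob L x Y * G (config_of Y))"
        by (intro tendsto_intros approx_cyl_prob_tendsto T g_lim)
      also have "(\<Sum>Y<CARD('s)^L. cyl_prob L x Y * G (config_of Y)) = P G x"
        unfolding P_eq_sum[OF L] by (simp add: mult.commute)
      finally have "\<forall>\<^sub>F q in sequentially. c' + P G x <
          c + (\<Sum>Y<CARD('s)^L. (real (approx_cyl_prob T q L x Y) / real q ^ L) * (real (g q Y) / real q))"
        using c'(2) by (intro order_tendstoD(1)) auto
      then show ?thesis
        using eventually_gt_at_top[of 0]
      proof eventually_elim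
        case (elim q)
        let ?S = "\<Sum>Y<CARD('s)^L. real (approx_cyl_prob T q L x Y) * real (g q Y)"
        have q: "0 < real q" using elim by simp
        have "real (g q (code_of L x)) \<le> real q * G x"
          using g_le[of q "code_of L x"] by (simp add: depends_on_config_of[OF L])
        then have "real (h x) + real (g q (code_of L x)) / real q \<le> real (h x) + G x"
          using q by (simp add: field_simps)
        also have "\<dots> \<le> c + (\<Sum>Y<CARD('s)^L. (real (approx_cyl_prob T q L x Y) / real q ^ L) * (real (g q Y) / real q))"
          using G(3)[of x] elim(1) by simp
        also have "\<dots> = c + ?S / (real q ^ L * real q)"
          by (simp add: sum_divide_distrib)
        finally have "(real (h x) + real (g q (code_of L x)) / real q) * (real q ^ L * real q) \<le>
            (c + ?S / (real q ^ L * real q)) * (real q ^ L * real q)"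
          using q by (intro mult_right_mono) auto
        then have "real (h x) * real q ^ Suc L + real (g q (code_of L x)) * real q ^ L \<le>
            (c * real q) * real q ^ L + ?S"
        proof -
          have "(r + s / real q) * (Q * real q) = r * (real q * Q) + s * Q"
            "(c + s / (Q * real q)) * (Q * real q) = (c * real q) * Q + s" if "0 < Q" for r s Q
            using q that by (simp_all add: field_simps)
          with \<open>_ \<le> (c + ?S / (real q ^ L * real q)) * (real q ^ L * real q)\<close>
          show ?thesis using q by simp
        qed
        also have "\<dots> \<le> real (nat \<lceil>c * real q\<rceil>) * real q ^ L + ?S"
          using q by (intro add_right_mono mult_right_mono real_nat_ceiling_ge) auto
        finally have "real (h x * q ^ Suc L + g q (code_of L x) * q ^ L) \<le>
            real (nat \<lceil>c * real q\<rceil> * q ^ L + (\<Sum>Y<CARD('s)^L. approx_cyl_prob T q L x Y * g q Y))"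
          by simp
        then show ?case by (simp only: of_nat_le_iff)
      qed
    qed
    \<comment> \<open>The threshold for \<open>q\<close> depends on the configuration, but only
      finitely many codes have to be checked.\<close>
    have "\<forall>\<^sub>F q in sequentially. \<forall>X\<in>{..<CARD('s)^M}. h (config_of X) * q ^ Suc L + g q (code_of L (config_of X :: ('d, 's) config)) * q ^ L \<le>
        nat \<lceil>c * real q\<rceil> * q ^ L + (\<Sum>Y<CARD('s)^L. approx_cyl_prob T q L (config_of X) Y * g q Y)"
      by (intro eventually_ball_finite ballI ev) simp
    then show ?thesis
      by eventually_elim (auto simp: certificate_def code_of_config_of)
  qed
  then show ?thesis by blast
qed

text \<open>The iterated \<open>rec_fn_tl\<close> carry the parameters below the binders for
  \<open>X\<close>, \<open>Y\<close> and \<open>k\<close>.\<close>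

lemma rec_pred_certificate:
  assumes T: "rec_fn 2 (\<lambda>xs. T (xs ! 0) (xs ! 1))"
    and h: "rec_fn (Suc n) (\<lambda>xs. h (xs ! 0) (tl xs))"
    and L: "rec_fn n L" and M: "rec_fn n M" and q: "rec_fn n q" and a: "rec_fn n a" and B: "rec_fn n B" and G: "rec_fn n G"
  shows "rec_pred n (\<lambda>xs. certificate T (\<lambda>X. h X xs) (L xs) (M xs) (q xs) (a xs) (digit (B xs) (G xs)))"
  unfolding certificate_def approx_cyl_prob_def
  by (intro rec_fn_intros rec_fn_digit rec_fn_key rec_fn_comp2[OF T] h M rec_fn_tl[OF L] rec_fn_tl[OF q] rec_fn_tl[OF a]
      rec_fn_tl[OF B] rec_fn_tl[OF G] rec_fn_tl[OF rec_fn_tl[OF L]] rec_fn_tl[OF rec_fn_tl[OF q]]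
      rec_fn_tl[OF rec_fn_tl[OF B]] rec_fn_tl[OF rec_fn_tl[OF G]] rec_fn_tl[OF rec_fn_tl[OF rec_fn_tl[OF q]]]) auto

section \<open>Two-sided bounds from a pair of certificates\<close>

text \<open>The last clause says \<open>a / q + a' / q < 1 + 1 / n\<close>; \<open>G\<close> and \<open>G'\<close> code functions in base \<open>B\<close>.\<close>

definition witness :: "(nat \<Rightarrow> nat \<Rightarrow> nat) \<Rightarrow> nat \<Rightarrow> nat \<Rightarrow> nat \<Rightarrow> nat \<Rightarrow> nat \<Rightarrow> nat \<Rightarrow> nat \<Rightarrow> nat \<Rightarrow> nat \<Rightarrow> nat \<Rightarrow> bool" where
  "witness T c n L M q B a a' G G' \<longleftrightarrow>
    covers L M \<and> (\<forall>e<c. idx_of_code (CARD('d) - 1) (pfst e) < M) \<and>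
    certificate T (\<lambda>X. of_bool (event c (config_of X :: ('d, 's) config))) L M q a (digit B G) \<and>
    certificate T (\<lambda>X. of_bool (\<not> event c (config_of X :: ('d, 's) config))) L M q a' (digit B G') \<and>
    n * (a + a') < q + n * q"

lemma integral_event:
  assumes "local_fn (event c :: ('d, 's) config \<Rightarrow> bool)"
  shows "integral\<^sup>L \<pi> (\<lambda>x. real (of_bool (event c x))) = measure \<pi> {x. event c x}"
    and "integral\<^sup>L \<pi> (\<lambda>x. real (of_bool (\<not> event c x))) = 1 - measure \<pi> {x. event c x}"
proof -
  interpret prob_space \<pi> by (rule prob_\<pi>)
  have sp: "space \<pi> = UNIV" using sets_eq_imp_space_eq[OF prob_\<pi>(2)] by simp
  have ev: "{x. event c x} \<in> events"
    using assms local_sets_sets[of "{x. event c x}"] prob_\<pi>(2) by (simp add: local_sets_def)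
  have eq: "(\<lambda>x. real (of_bool (event c x))) = indicator {x. event c x}" by (auto simp: fun_eq_iff)
  show "integral\<^sup>L \<pi> (\<lambda>x. real (of_bool (event c x))) = measure \<pi> {x. event c x}"
    unfolding eq using ev by (simp add: sp)
  have eq': "(\<lambda>x. real (of_bool (\<not> event c x))) = indicator (space \<pi> - {x. event c x})"
    by (auto simp: fun_eq_iff sp)
  show "integral\<^sup>L \<pi> (\<lambda>x. real (of_bool (\<not> event c x))) = 1 - measure \<pi> {x. event c x}"
    unfolding eq' using ev prob_compl[OF ev] by (simp add: sp)
qed

lemma local_fn_event: "local_fn (event c :: ('d, 's) config \<Rightarrow> bool)"
proof -
  obtain M where "\<forall>e\<in>(\<lambda>e. idx_of_code (CARD('d) - 1) (pfst e)) ` {..<c}. e < M"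
    using finite_nat_set_iff_bounded[of "(\<lambda>e. idx_of_code (CARD('d) - 1) (pfst e)) ` {..<c}"] by auto
  then have "depends_on M (event c :: ('d, 's) config \<Rightarrow> bool)"
    by (intro depends_on_event) auto
  then show ?thesis by (auto simp: local_fn_def)
qed

text \<open>The two certificates enclose the measure between \<open>1 - a' / q\<close> and
  \<open>a / q\<close>, and the last clause of \<open>witness\<close> says that this interval is
  shorter than \<open>1 / n\<close>.\<close>

lemma witness_sound:
  assumes T: "lower_table T" and w: "witness T c n L M q B a a' G G'" and n: "0 < n"
  shows "\<bar>real a / real q - measure \<pi> {x. event c x}\<bar> < 1 / real n"
proof -
  have *: "n * (a + a') < q + n * q" using w by (simp add: witness_def)
  \<comment> \<open>For \<open>q = 0\<close> the right-hand side would be 0, which no natural number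
    undercuts.\<close>
  then have q: "0 < q" by (cases q) auto
  have dep: "depends_on M (event c :: ('d, 's) config \<Rightarrow> bool)"
    using w by (intro depends_on_event) (auto simp: witness_def)
  have "depends_on M (\<lambda>x :: ('d, 's) config. of_bool (event c x) :: nat)"
    "depends_on M (\<lambda>x :: ('d, 's) config. of_bool (\<not> event c x) :: nat)"
    using dep by (auto simp: depends_on_def)
  from certificate_sound[OF T q _ this(1)] certificate_sound[OF T q _ this(2)]
  have le: "measure \<pi> {x. event c x} \<le> real a / real q" "1 - measure \<pi> {x. event c x} \<le> real a' / real q"
    using w integral_event[OF local_fn_event, of c] by (auto simp: witness_def)
  have "real (n * (a + a')) < real (q + n * q)" using * by (simp only: of_nat_less_iff)
  then have "real a / real q + real a' / real q < 1 + 1 / real n"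
    using n q by (simp add: field_simps)
  with le n show ?thesis by (auto simp: abs_less_iff)
qed

text \<open>Stated for every \<open>c\<close> and \<open>n\<close>, since the search must be total;
  for \<open>n = 0\<close> the last clause of \<open>witness\<close> only asks for
  \<open>0 < q\<close>.\<close>

lemma witness_complete:
  assumes T: "lower_table T"
  shows "\<exists>L M q B a a' G G'. witness T c n L M q B a a' G G'"
proof -
  define p where "p = measure \<pi> {x. event c x}"
  \<comment> \<open>With this choice \<open>2 * e * n\<close> is at most \<open>1 / 2\<close>, so
    the slack of both certificates consumes at most half of the tolerance \<open>q\<close>. The
    summand 1 covers \<open>n = 0\<close>.\<close>
  define e where "e = 1 / (4 * (real n + 1))"
  have e: "0 < e" by (simp add: e_def)
  let ?h = "\<lambda>x :: ('d, 's) config. of_bool (event c x) :: nat"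
  let ?h' = "\<lambda>x :: ('d, 's) config. of_bool (\<not> event c x) :: nat"
  have loc: "local_fn ?h" "local_fn ?h'" using local_fn_event by (auto intro: local_fn_comp)
  have lt: "integral\<^sup>L \<pi> (\<lambda>x. real (?h x)) < p + e" "integral\<^sup>L \<pi> (\<lambda>x. real (?h' x)) < 1 - p + e"
    unfolding integral_event[OF local_fn_event] using e by (simp_all add: p_def)
  obtain L0 where L0: "\<forall>L\<ge>L0. \<forall>M. \<forall>\<^sub>F q in sequentially.
      \<exists>g. certificate T (\<lambda>X. ?h (config_of X)) L M q (nat \<lceil>(p + e) * real q\<rceil>) g"
    using certificate_complete[OF T loc(1) lt(1)] by (elim exE)
  obtain L0' where L0': "\<forall>L\<ge>L0'. \<forall>M. \<forall>\<^sub>F q in sequentially.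
      \<exists>g. certificate T (\<lambda>X. ?h' (config_of X)) L M q (nat \<lceil>(1 - p + e) * real q\<rceil>) g"
    using certificate_complete[OF T loc(2) lt(2)] by (elim exE)
  define L where "L = max L0 L0'"
  have "finite ((\<lambda>(k, n). site_shift n k) ` ({..<L} \<times> set ns) \<union> (\<lambda>e. idx_of_code (CARD('d) - 1) (pfst e)) ` {..<c})" by simp
  then obtain M0 where M0: "\<And>i. i \<in> (\<lambda>(k, n). site_shift n k) ` ({..<L} \<times> set ns) \<union>
      (\<lambda>e. idx_of_code (CARD('d) - 1) (pfst e)) ` {..<c} \<Longrightarrow> i < M0"
    unfolding finite_nat_set_iff_bounded by blast
  define M where "M = max M0 L"
  have cov: "covers L M" "\<forall>e<c. idx_of_code (CARD('d) - 1) (pfst e) < M"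
    using M0 unfolding covers_def M_def by (force simp: less_max_iff_disj)+
  \<comment> \<open>Rounding the two bounds up costs at most 2, hence \<open>2 * n\<close> after
    multiplication by \<open>n\<close>; \<open>4 * n < q\<close> keeps this below the other half of
    the tolerance.\<close>
  have "\<forall>\<^sub>F q in sequentially. 4 * n < q \<and>
      (\<exists>g. certificate T (\<lambda>X. ?h (config_of X)) L M q (nat \<lceil>(p + e) * real q\<rceil>) g) \<and>
      (\<exists>g. certificate T (\<lambda>X. ?h' (config_of X)) L M q (nat \<lceil>(1 - p + e) * real q\<rceil>) g)"
    by (intro eventually_conj eventually_gt_at_top L0[rule_format] L0'[rule_format]) (simp_all add: L_def)
  then obtain q g g' where q: "4 * n < q"
    and g: "certificate T (\<lambda>X. ?h (config_of X)) L M q (nat \<lceil>(p + e) * real q\<rceil>) g"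
      "certificate T (\<lambda>X. ?h' (config_of X)) L M q (nat \<lceil>(1 - p + e) * real q\<rceil>) g'"
    using eventually_happens'[OF sequentially_bot] by blast
  \<comment> \<open>A base exceeding all values of both functions on the window, so that these
    values can serve as digits.\<close>
  define B where "B = Suc (\<Sum>Y<CARD('s)^L. g Y + g' Y)"
  define enc where "enc h = (\<Sum>Y<CARD('s)^L. h Y * B ^ Y)" for h
  have B: "g Y < B" "g' Y < B" if "Y < CARD('s)^L" for Y
    using member_le_sum[of Y "{..<CARD('s)^L}" "\<lambda>Y. g Y + g' Y"] that by (auto simp: B_def)
  have digit: "digit B (enc g) Y = g Y" "digit B (enc g') Y = g' Y" if "Y < CARD('s)^L" for Y
    unfolding enc_def using B that by (simp_all add: digit_sum)
  have cert_cong: "certificate T h L M q a k" if "certificate T h L M q a k'"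
    "\<And>Y. Y < CARD('s)^L \<Longrightarrow> k Y = k' Y" for h a k k'
    using that by (simp add: certificate_def)
  have p: "0 \<le> p" "p \<le> 1"
    unfolding p_def by (rule measure_nonneg, rule prob_space.prob_le_1[OF prob_\<pi>(1)])
  let ?a = "nat \<lceil>(p + e) * real q\<rceil>" and ?a' = "nat \<lceil>(1 - p + e) * real q\<rceil>"
  have "real ?a \<le> (p + e) * real q + 1" "real ?a' \<le> (1 - p + e) * real q + 1"
  proof -
    have "real (nat \<lceil>r\<rceil>) \<le> r + 1" if "0 \<le> r" for r
      using that by linarith
    moreover have "0 \<le> (p + e) * real q" "0 \<le> (1 - p + e) * real q" using p e by simp_all
    ultimately show "real ?a \<le> (p + e) * real q + 1" "real ?a' \<le> (1 - p + e) * real q + 1"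
      by blast+
  qed
  then have "real ?a + real ?a' \<le> real q + 2 * e * real q + 2" by (simp add: algebra_simps)
  then have "real n * (real ?a + real ?a') \<le> real n * (real q + 2 * e * real q + 2)"
    by (rule mult_left_mono) simp
  also have "\<dots> = real n * real q + real q * (real n * (2 * e)) + 2 * real n" by (simp add: algebra_simps)
  also have "real q * (real n * (2 * e)) \<le> real q * (1 / 2)"
    by (intro mult_left_mono) (simp_all add: e_def field_simps)
  finally have "real (n * (?a + ?a')) < real (q + n * q)" using q by simp
  then have "n * (?a + ?a') < q + n * q" by (simp only: of_nat_less_iff)
  then have "witness T c n L M q B ?a ?a' (enc g) (enc g')"
    unfolding witness_def using cov cert_cong[OF g(1) digit(1)] cert_cong[OF g(2) digit(2)] by simp
  then show ?thesis by blast
qed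

section \<open>The search\<close>

definition witness_code :: "(nat \<Rightarrow> nat \<Rightarrow> nat) \<Rightarrow> nat \<Rightarrow> nat \<Rightarrow> nat \<Rightarrow> bool" where
  "witness_code T c n w \<longleftrightarrow>
    witness T c n (pfst w) (pfst (psnd w)) (pfst (psnd (psnd w))) (pfst (psnd (psnd (psnd w))))
      (pfst (psnd (psnd (psnd (psnd w))))) (pfst (psnd (psnd (psnd (psnd (psnd w))))))
      (pfst (psnd (psnd (psnd (psnd (psnd (psnd w)))))))
      (psnd (psnd (psnd (psnd (psnd (psnd (psnd w)))))))"

lemma rec_pred_covers:
  assumes "rec_fn n L" "rec_fn n M"
  shows "rec_pred n (\<lambda>xs. covers (L xs) (M xs))"
  unfolding covers_def
  by (intro rec_fn_intros rec_pred_list_all rec_fn_site_shift assms rec_fn_tl[OF assms(2)]) auto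

lemma rec_pred_witness_code:
  assumes T: "rec_fn 2 (\<lambda>xs. T (xs ! 0) (xs ! 1))"
  shows "rec_pred 3 (\<lambda>xs. witness_code T (xs ! 1) (xs ! 2) (xs ! 0))"
  unfolding witness_code_def witness_def
  by (intro rec_fn_intros rec_pred_covers rec_fn_idx_of_code rec_pred_certificate[OF T] rec_pred_event; simp)

lemma computable_invariant_measure:
  assumes "computable_rule ns \<phi>"
  shows "computable_measure \<pi>"
proof -
  obtain T where T: "rec_fn 2 (\<lambda>xs. T (xs ! 0) (xs ! 1))" "lower_table T"
    using computable_rule_table[OF assms \<phi>_bounds(1)] unfolding lower_table_def by blast
  have ex: "\<exists>w. witness_code T c n w" for c n
  proof -
    obtain L M q B a a' G G' where "witness T c n L M q B a a' G G'"
      using witness_complete[OF T(2)] by blast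
    then have "witness_code T c n (prod_encode (L, prod_encode (M, prod_encode (q, prod_encode (B,
        prod_encode (a, prod_encode (a', prod_encode (G, G'))))))))"
      by (simp add: witness_code_def)
    then show ?thesis ..
  qed
  \<comment> \<open>The unbounded search itself: the least code of a witness, from which the
    numerator \<open>a\<close> and the denominator \<open>q\<close> are read off.\<close>
  define w where "w c n = (LEAST w. witness_code T c n w)" for c n
  define num den where "num c n = pfst (psnd (psnd (psnd (psnd (w c n)))))"
    and "den c n = pfst (psnd (psnd (w c n)))" for c n
  have "rec_fn 2 (\<lambda>xs. w (xs ! 0) (xs ! 1))"
    unfolding w_def
  proof (rule rec_fn_Least)
    have "rec_pred 3 (\<lambda>xs. witness_code T (tl xs ! 0) (tl xs ! 1) (xs ! 0))"
      by (rule rec_pred_cong[OF rec_pred_witness_code[OF T(1)]]) (simp add: nth_tl numeral_2_eq_2)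
    then show "rec_pred (Suc 2) (\<lambda>xs. witness_code T (tl xs ! 0) (tl xs ! 1) (xs ! 0))" by simp
  qed (rule ex)
  \<comment> \<open>Even codes stand for nonnegative integers, so doubling encodes numerator and
    denominator in the form that \<open>nat_to_rat_surj\<close> reads.\<close>
  then have "rec_fn 2 (\<lambda>xs. prod_encode (2 * num (xs ! 0) (xs ! 1), 2 * den (xs ! 0) (xs ! 1)))"
    unfolding num_def den_def by (intro rec_fn_intros)
  then obtain g where g: "recursive_fn 2 g"
    "\<And>c n. g [c, n] = prod_encode (2 * num c n, 2 * den c n)"
    unfolding rec_fn_def by force
  have rat: "real_of_rat (nat_to_rat_surj (prod_encode (2 * a, 2 * b))) = real a / real b" for a b
    by (cases "b = 0")
      (simp_all add: nat_to_rat_surj_def int_decode_def sum_decode_def of_rat_rat rat_number_collapse)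
  have "\<bar>real_of_rat (nat_to_rat_surj (g [pattern_code u, n])) - measure \<pi> (cylinder u)\<bar> < 1 / real n"
    if u: "u \<in> patterns" and n: "0 < n" for u :: "('d, 's) pattern" and n
  proof -
    have "witness_code T (pattern_code u) n (w (pattern_code u) n)"
      unfolding w_def using ex by (rule LeastI_ex)
    from witness_sound[OF T(2) this[unfolded witness_code_def] n]
    show ?thesis by (simp add: g(2) rat num_def den_def cylinder_eq_event[OF u])
  qed
  then show ?thesis
    unfolding computable_measure_def computable_pattern_fn_def using g(1)
    by (intro exI[of _ "\<lambda>u n. nat_to_rat_surj (g [pattern_code u, n])"]) auto
qed

end

theorem proposition2p2:
  fixes ns :: "(int ^ 'd::finite) list"
    and \<phi> :: "'s::finite list \<Rightarrow> 's \<Rightarrow> real"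
    and \<Phi> :: "('d, 's) config \<Rightarrow> ('d, 's) config measure"
    and \<pi> :: "('d, 's) config measure"
  assumes "pca ns \<phi> \<Phi>"
    and "computable_rule ns \<phi>"
    and "invariant_measure \<Phi> \<pi>"
    and "\<And>\<mu>. invariant_measure \<Phi> \<mu> \<Longrightarrow> \<mu> = \<pi>"
  shows "computable_measure \<pi>"
proof -
  interpret uniquely_ergodic_pca ns \<phi> \<Phi> \<pi>
    using assms by unfold_locales
  show ?thesis using assms(2) by (rule computable_invariant_measure)
qed

end
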